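(* Let $\epsilon>0$ and let $N$ be a positive integer. The set $\{\Phi\in\mathfrak{S}_N : \Phi \text{ satisfies the SESC}\}$ contains a subset of $\mathfrak{S}_N$ that is open and dense in $\mathfrak{S}_N$ with respect to the $\mathcal{C}^2$ topology (the topology induced by the metric $d_2$).
   Context: Fix $\epsilon>0$, write $I=[0,1]$ and, for $\delta>0$, $\mathcal{B}_\delta=\{z\in\mathbb{C}: \exists x\in I,\ |z-x|<\delta\}$. $\mathcal{S}^\omega_\epsilon(I)$ is the class of maps $f:\mathbb{R}\to\mathbb{R}$ such that: (A) $f$ is (extends to be) complex analytic on $\mathcal{B}_{2\epsilon}$; (B) $f(I)\subseteq I$ and $f(\overline{\mathcal{B}_\epsilon})\subseteq\mathcal{B}_\epsilon$; (C) $0<|f'(x)|<1$ for all $x\in\overline{\mathcal{B}_\epsilon}$. $\mathfrak{S}_N$ is the set of ordered $N$-tuples (IFSs) $\Phi=(f_i)_{i=1}^N$ with $f_i\in\mathcal{S}^\omega_\epsilon(I)$. For $f,g\in\mathcal{S}^\omega_\epsilon(I)$, $d_2(f,g)=\sup_{x\in I}|f(x)-g(x)|+\sup_{x\in I}|f'(x)-g'(x)|+\sup_{x\in I}|f''(x)-g''(x)|$, and $d_2((f_i)_{i=1}^N,(g_i)_{i=1}^N)=\max_i d_2(f_i,g_i)$ on $\mathfrak{S}_N$. Let $\mathcal{I}=\{1,\dots,N\}$, $\Sigma_n=\mathcal{I}^n$, and $f_{\mathbf{i}}=f_{i_1}\circ\cdots\circ f_{i_n}$ for $\mathbf{i}=(i_1,\dots,i_n)\in\Sigma_n$.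 $\Phi$ satisfies the strong exponential separation condition (SESC) if there exists $c>0$ such that $\sup_{x\in[0,1]}|f_{\mathbf{i}}(x)-f_{\mathbf{j}}(x)|\ge c^n$ for all $n\in\mathbb{N}$ and all $\mathbf{i}\ne\mathbf{j}$ in $\Sigma_n$. *)

theory Defs
  imports "HOL-Complex_Analysis.Complex_Analysis"
begin

definition B_nbhd :: "real \<Rightarrow> complex set" where
  "B_nbhd \<delta> = {z. \<exists>x\<in>{0..1::real}. cmod (z - complex_of_real x) < \<delta>}"

text \<open>
  \<open>F\<close> is the complex extension of \<open>f\<close>; it is uniquely determined on \<open>B_nbhd (2 * \<epsilon>)\<close>. Outside the
  real trace of that set the values of \<open>f\<close> are unconstrained.
\<close>

definition S_omega :: "real \<Rightarrow> (real \<Rightarrow> real) set" where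
  "S_omega \<epsilon> = {f. \<exists>F::complex \<Rightarrow> complex.
      F analytic_on B_nbhd (2 * \<epsilon>) \<and>
      (\<forall>x::real. complex_of_real x \<in> B_nbhd (2 * \<epsilon>) \<longrightarrow>
         F (complex_of_real x) = complex_of_real (f x)) \<and>
      f ` {0..1} \<subseteq> {0..1} \<and>
      F ` closure (B_nbhd \<epsilon>) \<subseteq> B_nbhd \<epsilon> \<and>
      (\<forall>z\<in>closure (B_nbhd \<epsilon>). 0 < cmod (deriv F z) \<and> cmod (deriv F z) < 1)}"

definition IFS :: "real \<Rightarrow> nat \<Rightarrow> (nat \<Rightarrow> real \<Rightarrow> real) set" where
  "IFS \<epsilon> N = {1..N} \<rightarrow>\<^sub>E S_omega \<epsilon>"

definition d2 :: "(real \<Rightarrow> real) \<Rightarrow> (real \<Rightarrow> real) \<Rightarrow> real" where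
  "d2 f g = (SUP x\<in>{0..1}. \<bar>f x - g x\<bar>)
          + (SUP x\<in>{0..1}. \<bar>deriv f x - deriv g x\<bar>)
          + (SUP x\<in>{0..1}. \<bar>deriv (deriv f) x - deriv (deriv g) x\<bar>)"

definition d2_IFS :: "nat \<Rightarrow> (nat \<Rightarrow> real \<Rightarrow> real) \<Rightarrow> (nat \<Rightarrow> real \<Rightarrow> real) \<Rightarrow> real" where
  "d2_IFS N \<Phi> \<Psi> = Max ((\<lambda>i. d2 (\<Phi> i) (\<Psi> i)) ` {1..N})"

text \<open>
  The library locale \<open>Metric_space\<close> does not apply literally: two maps on the real line that agree
  near \<open>{0..1}\<close> but differ far away have distance zero. The topology of the balls is
  therefore defined directly, by the same formula as in that locale.
\<close>

definition C2_topology :: "real \<Rightarrow> nat \<Rightarrow> (nat \<Rightarrow> real \<Rightarrow> real) topology" where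
  "C2_topology \<epsilon> N = topology (\<lambda>U. U \<subseteq> IFS \<epsilon> N \<and>
     (\<forall>\<Phi>\<in>U. \<exists>r>0. {\<Psi> \<in> IFS \<epsilon> N. d2_IFS N \<Phi> \<Psi> < r} \<subseteq> U))"

lemma openin_C2_topology:
  "openin (C2_topology \<epsilon> N) U \<longleftrightarrow>
     U \<subseteq> IFS \<epsilon> N \<and> (\<forall>\<Phi>\<in>U. \<exists>r>0. {\<Psi> \<in> IFS \<epsilon> N. d2_IFS N \<Phi> \<Psi> < r} \<subseteq> U)"
proof -
  let ?P = "\<lambda>U. U \<subseteq> IFS \<epsilon> N \<and> (\<forall>\<Phi>\<in>U. \<exists>r>0. {\<Psi> \<in> IFS \<epsilon> N. d2_IFS N \<Phi> \<Psi> < r} \<subseteq> U)"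
  have "istopology ?P"
    unfolding istopology_def
  proof (intro conjI allI impI)
    fix S T assume S: "?P S" and T: "?P T"
    show "S \<inter> T \<subseteq> IFS \<epsilon> N" using S by blast
    show "\<forall>\<Phi>\<in>S \<inter> T. \<exists>r>0. {\<Psi> \<in> IFS \<epsilon> N. d2_IFS N \<Phi> \<Psi> < r} \<subseteq> S \<inter> T"
    proof
      fix \<Phi> assume "\<Phi> \<in> S \<inter> T"
      then obtain r s where "r > 0" "{\<Psi> \<in> IFS \<epsilon> N. d2_IFS N \<Phi> \<Psi> < r} \<subseteq> S"
        and "s > 0" "{\<Psi> \<in> IFS \<epsilon> N. d2_IFS N \<Phi> \<Psi> < s} \<subseteq> T"
        using S T by blast
      then show "\<exists>r>0. {\<Psi> \<in> IFS \<epsilon> N. d2_IFS N \<Phi> \<Psi> < r} \<subseteq> S \<inter> T"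
        by (intro exI[of _ "min r s"]) auto
    qed
  next
    fix K assume K: "\<forall>S\<in>K. ?P S"
    show "\<Union>K \<subseteq> IFS \<epsilon> N" using K by blast
    show "\<forall>\<Phi>\<in>\<Union>K. \<exists>r>0. {\<Psi> \<in> IFS \<epsilon> N. d2_IFS N \<Phi> \<Psi> < r} \<subseteq> \<Union>K"
    proof
      fix \<Phi> assume "\<Phi> \<in> \<Union>K"
      then obtain S where "S \<in> K" "\<Phi> \<in> S" by blast
      then obtain r where "r > 0" "{\<Psi> \<in> IFS \<epsilon> N. d2_IFS N \<Phi> \<Psi> < r} \<subseteq> S"
        using K by blast
      then show "\<exists>r>0. {\<Psi> \<in> IFS \<epsilon> N. d2_IFS N \<Phi> \<Psi> < r} \<subseteq> \<Union>K"
        using \<open>S \<in> K\<close> by blast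
    qed
  qed
  then show ?thesis
    by (simp add: C2_topology_def topology_inverse')
qed

lemma topspace_C2_topology [simp]: "topspace (C2_topology \<epsilon> N) = IFS \<epsilon> N"
proof
  show "topspace (C2_topology \<epsilon> N) \<subseteq> IFS \<epsilon> N"
    using openin_C2_topology[of \<epsilon> N "topspace (C2_topology \<epsilon> N)"] by simp
  have "\<exists>r::real. r > 0" by (rule exI[of _ 1]) simp
  then have "openin (C2_topology \<epsilon> N) (IFS \<epsilon> N)"
    by (auto simp: openin_C2_topology)
  then show "IFS \<epsilon> N \<subseteq> topspace (C2_topology \<epsilon> N)" by (rule openin_subset)
qed

definition words :: "nat \<Rightarrow> nat \<Rightarrow> nat list set" where
  "words N n = {w. length w = n \<and> set w \<subseteq> {1..N}}"

definition comp_word :: "(nat \<Rightarrow> real \<Rightarrow> real) \<Rightarrow> nat list \<Rightarrow> real \<Rightarrow> real" where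
  "comp_word \<Phi> w = foldr (\<lambda>i g. \<Phi> i \<circ> g) w id"

definition SESC :: "nat \<Rightarrow> (nat \<Rightarrow> real \<Rightarrow> real) \<Rightarrow> bool" where
  "SESC N \<Phi> \<longleftrightarrow> (\<exists>c::real. c > 0 \<and>
     (\<forall>n::nat. \<forall>u\<in>words N n. \<forall>v\<in>words N n. u \<noteq> v \<longrightarrow>
        (SUP x\<in>{0..1}. \<bar>comp_word \<Phi> u x - comp_word \<Phi> v x\<bar>) \<ge> c ^ n))"

end

theory Submission
  imports Defs
begin

text \<open>
  The nonlinearity \<open>f'' / f'\<close> is a cocycle: for \<open>f_w \<circ> f_k\<close> it equals
  \<open>N(f_k) + f_k' * (N(f_w) \<circ> f_k)\<close>, a series that converges geometrically and is dominated by the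
  innermost maps. The open dense set consists of the systems for which there is a uniform gap on
  the unit interval between the nonlinearities of any two words with different innermost letters.

  The gap implies the SESC. Cancel the common innermost part of two words; it maps the unit
  interval onto an interval \<open>J\<close> that is at least exponentially large in the length of the words. The
  nonlinearities form a normal family, so by Montel's theorem some derivative of bounded order of
  their difference is bounded below at every point, and hence by Landau's inequality the difference
  is polynomially large in the length of \<open>J\<close> somewhere on \<open>J\<close>. Landau's inequality also passes from
  there back to the maps.

  The gap is stable since the cocycle is a \<open>C\<^sup>2\<close>-continuous contraction. It is dense since one may
  add to \<open>f_k\<close> a multiple of \<open>z ^ n - z\<close> with \<open>n\<close> large: at a suitable point near \<open>1 + \<epsilon>\<close>, which no
  map of the system reaches, this makes the nonlinearity equal to a prescribed large multiple of \<open>k\<close>,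
  while it is small in \<open>C\<^sup>1\<close> on the whole neighbourhood and in \<open>C\<^sup>2\<close> on the images.
\<close>

section \<open>Landau's inequality\<close>

lemma norm_linearization_error_le:
  fixes f :: "real \<Rightarrow> 'a::real_normed_vector"
  assumes f: "\<And>x. x \<in> {a..b} \<Longrightarrow> (f has_vector_derivative f' x) (at x within {a..b})"
    and f': "\<And>x. x \<in> {a..b} \<Longrightarrow> (f' has_vector_derivative f'' x) (at x within {a..b})"
    and f'': "\<And>x. x \<in> {a..b} \<Longrightarrow> norm (f'' x) \<le> M"
    and xy: "x \<in> {a..b}" "y \<in> {a..b}"
  shows "norm (f y - f x - (y - x) *\<^sub>R f' x) \<le> M * (y - x)\<^sup>2"
proof -
  let ?S = "closed_segment x y"
  have S: "?S \<subseteq> {a..b}"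
    using xy by (intro closed_segment_subset) auto
  have f'_close: "norm (f' z - f' x) \<le> M * \<bar>y - x\<bar>" if "z \<in> ?S" for z
  proof -
    have "norm (f' z - f' x) \<le> M * norm (z - x)"
    proof (rule differentiable_bound)
      show "(f' has_derivative (\<lambda>t. t *\<^sub>R f'' u)) (at u within ?S)" if "u \<in> ?S" for u
        using has_vector_derivative_within_subset[OF f' S] that S
        by (auto simp: has_vector_derivative_def)
      show "onorm (\<lambda>t. t *\<^sub>R f'' u) \<le> M" if "u \<in> ?S" for u
        using f''[of u] that S
        by (intro onorm_le) (auto simp: mult.commute[of M] intro!: mult_left_mono)
    qed (use that in auto)
    also have "\<dots> \<le> M * \<bar>y - x\<bar>"
      using segment_bound1[OF that] f''[OF xy(1)]
      by (intro mult_left_mono) (auto simp: abs_minus_commute intro: order_trans[OF norm_ge_zero])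
    finally show ?thesis .
  qed
  have "norm (f y - f x - (y - x) *\<^sub>R f' x) \<le> norm (y - x) * (M * \<bar>y - x\<bar>)"
    using f'_close S
    by (intro vector_differentiable_bound_linearization[where S = ?S])
      (auto intro: has_vector_derivative_within_subset[OF f])
  then show ?thesis by (simp add: power2_eq_square mult_ac flip: abs_mult)
qed

lemma Landau_inequality:
  fixes f :: "real \<Rightarrow> 'a::real_normed_vector"
  assumes f: "\<And>x. x \<in> {a..b} \<Longrightarrow> (f has_vector_derivative f' x) (at x within {a..b})"
    and f': "\<And>x. x \<in> {a..b} \<Longrightarrow> (f' has_vector_derivative f'' x) (at x within {a..b})"
    and f'': "\<And>x. x \<in> {a..b} \<Longrightarrow> norm (f'' x) \<le> M"
    and f_le: "\<And>x. x \<in> {a..b} \<Longrightarrow> norm (f x) \<le> B"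
    and x: "x \<in> {a..b}" and h: "0 \<le> h" "2 * h \<le> b - a"
  shows "h * norm (f' x) \<le> 2 * B + M * h\<^sup>2"
proof -
  obtain y where y: "y \<in> {a..b}" "\<bar>y - x\<bar> = h"
    using x h by (cases "x + h \<le> b") (auto intro: that[of "x + h"] that[of "x - h"])
  have "norm (f y - f x - (y - x) *\<^sub>R f' x) \<le> M * h\<^sup>2"
    using norm_linearization_error_le[OF f f' f'' x y(1)] unfolding y(2)[symmetric] by simp
  moreover have "norm w \<le> norm (u - v - w) + norm u + norm v" for u v w :: 'a
    by norm
  ultimately have "norm ((y - x) *\<^sub>R f' x) \<le> M * h\<^sup>2 + norm (f y) + norm (f x)"
    by (meson add_right_mono order_trans)
  then show ?thesis
    using f_le[OF x] f_le[OF y(1)] y(2) by simp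
qed

lemma Landau_lower_bound:
  fixes f :: "real \<Rightarrow> 'a::real_normed_vector"
  assumes f: "\<And>x. x \<in> {a..b} \<Longrightarrow> (f has_vector_derivative f' x) (at x within {a..b})"
    and f': "\<And>x. x \<in> {a..b} \<Longrightarrow> (f' has_vector_derivative f'' x) (at x within {a..b})"
    and f'': "\<And>x. x \<in> {a..b} \<Longrightarrow> norm (f'' x) \<le> M"
    and \<theta>: "0 < \<theta>" "(4 + M) * \<theta> \<le> b - a" "b - a \<le> 1"
    and \<kappa>: "0 < \<kappa>" "\<kappa> \<le> 1" and x: "x \<in> {a..b}" "\<kappa> \<le> norm (f' x)"
  shows "\<exists>y\<in>{a..b}. (\<kappa> * \<theta>)\<^sup>2 \<le> norm (f y)"
proof (rule ccontr)
  let ?h = "\<kappa> * \<theta>"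
  assume "\<not> ?thesis"
  then have f_le: "norm (f y) \<le> ?h\<^sup>2" if "y \<in> {a..b}" for y
    using that by force
  have "0 \<le> M" using f''[OF x(1)] by (auto intro: order_trans[OF norm_ge_zero])
  have "?h \<le> \<theta>" using \<theta> \<kappa> by (simp add: mult_left_le_one_le)
  moreover have "4 * \<theta> \<le> (4 + M) * \<theta>" using \<open>0 \<le> M\<close> \<theta> by (intro mult_right_mono) auto
  ultimately have "2 * ?h \<le> b - a" using \<theta> by linarith
  have "\<kappa> * ?h \<le> norm (f' x) * ?h"
    using \<theta> \<kappa> x by (intro mult_right_mono) auto
  also have "\<dots> \<le> 2 * ?h\<^sup>2 + M * ?h\<^sup>2"
    using Landau_inequality[OF f f' f'' f_le x(1) _ \<open>2 * ?h \<le> b - a\<close>] \<theta> \<kappa>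
    by (simp add: mult.commute)
  finally have "\<kappa> * ?h * 1 \<le> \<kappa> * ?h * ((2 + M) * \<theta>)"
    by (simp add: algebra_simps power2_eq_square)
  then have "1 \<le> (2 + M) * \<theta>"
    using \<theta> \<kappa> by (subst (asm) mult_le_cancel_left_pos) auto
  also have "\<dots> < (4 + M) * \<theta>" using \<theta> by (intro mult_strict_right_mono) auto
  finally show False using \<theta> by simp
qed

lemma power_four_power_Suc_le:
  fixes q :: real
  assumes "0 \<le> q" "q \<le> 1"
  shows "q ^ 4 ^ Suc j \<le> (q ^ 4 ^ j * q)\<^sup>2"
proof -
  have "q ^ 4 ^ Suc j \<le> q ^ ((4 ^ j + 1) * 2)"
    using assms one_le_power[of "4::nat" j] by (intro power_decreasing) auto
  then show ?thesis by (simp only: power_mult power_add power_one_right)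
qed

lemma iterated_Landau_lower_bound:
  fixes f :: "nat \<Rightarrow> real \<Rightarrow> 'a::real_normed_vector"
  assumes f: "\<And>i x. i \<le> j \<Longrightarrow> x \<in> {a..b} \<Longrightarrow>
    (f i has_vector_derivative f (Suc i) x) (at x within {a..b})"
    and f_le: "\<And>i x. i \<le> Suc j \<Longrightarrow> x \<in> {a..b} \<Longrightarrow> norm (f i x) \<le> M"
    and \<theta>: "0 < \<theta>" "(4 + M) * \<theta> \<le> b - a" "b - a \<le> 1"
    and \<kappa>: "0 < \<kappa>" "\<kappa> \<le> 1" and x: "x \<in> {a..b}" "\<kappa> \<le> norm (f j x)"
  shows "\<exists>y\<in>{a..b}. (\<kappa> * \<theta>) ^ 4 ^ j \<le> norm (f 0 y)"
proof -
  have "0 \<le> M" using f_le[OF _ x(1), of 0] by (auto intro: order_trans[OF norm_ge_zero])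
  then have "1 * \<theta> \<le> (4 + M) * \<theta>" using \<theta> by (intro mult_right_mono) auto
  then have "\<theta> \<le> 1" using \<theta> by linarith
  show ?thesis
    using f f_le x(2)
  proof (induction j arbitrary: f)
    case (0 f)
    have "\<kappa> * \<theta> \<le> \<kappa>" using \<kappa> \<open>\<theta> \<le> 1\<close> by (simp add: mult_left_le)
    then show ?case using "0.prems"(3) x(1) by (intro bexI[of _ x]) auto
  next
    case (Suc j f)
    let ?q = "\<kappa> * \<theta>"
    have q: "0 < ?q" "?q \<le> 1" using \<theta> \<kappa> \<open>\<theta> \<le> 1\<close> by (auto intro: mult_le_one)
    have "\<exists>y\<in>{a..b}. ?q ^ 4 ^ j \<le> norm (f 1 y)"
      using Suc.IH[of "\<lambda>i. f (Suc i)"] Suc.prems by simp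
    then obtain y where y: "y \<in> {a..b}" "?q ^ 4 ^ j \<le> norm (f 1 y)" by blast
    have "\<exists>z\<in>{a..b}. (?q ^ 4 ^ j * \<theta>)\<^sup>2 \<le> norm (f 0 z)"
    proof (rule Landau_lower_bound[where f = "f 0" and f' = "f 1" and f'' = "f 2",
          OF _ _ _ \<theta> _ _ y])
      show "(f 0 has_vector_derivative f 1 t) (at t within {a..b})"
        "(f 1 has_vector_derivative f 2 t) (at t within {a..b})" "norm (f 2 t) \<le> M"
        if "t \<in> {a..b}" for t
        using Suc.prems(1)[of 0 t] Suc.prems(1)[of 1 t] Suc.prems(2)[of 2 t] that
        by (auto simp: numeral_2_eq_2)
    qed (use q in \<open>auto intro: power_le_one\<close>)
    moreover have "?q ^ 4 ^ Suc j \<le> (?q ^ 4 ^ j * \<theta>)\<^sup>2"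
    proof -
      have "?q ^ 4 ^ Suc j \<le> (?q ^ 4 ^ j * ?q)\<^sup>2"
        using q by (intro power_four_power_Suc_le) auto
      also have "\<dots> \<le> (?q ^ 4 ^ j * \<theta>)\<^sup>2"
        using q \<theta> \<kappa> by (intro power_mono mult_left_mono) (auto simp: mult_left_le_one_le)
      finally show ?thesis .
    qed
    ultimately show ?case by (meson order_trans)
  qed
qed

section \<open>Bounded families of holomorphic functions\<close>

definition bounded_holomorphic :: "complex set \<Rightarrow> real \<Rightarrow> (complex \<Rightarrow> complex) set" where
  "bounded_holomorphic S C = {g. g holomorphic_on S \<and> (\<forall>z\<in>S. cmod (g z) \<le> C)}"

lemma bounded_holomorphicI [intro?]:
  "g holomorphic_on S \<Longrightarrow> (\<And>z. z \<in> S \<Longrightarrow> cmod (g z) \<le> C) \<Longrightarrow> g \<in> bounded_holomorphic S C"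
  by (simp add: bounded_holomorphic_def)

lemma bounded_holomorphicD:
  assumes "g \<in> bounded_holomorphic S C"
  shows "g holomorphic_on S" "z \<in> S \<Longrightarrow> cmod (g z) \<le> C"
  using assms by (simp_all add: bounded_holomorphic_def)

lemma bounded_holomorphic_diff:
  assumes "f \<in> bounded_holomorphic S C" "g \<in> bounded_holomorphic S D"
  shows "(\<lambda>z. f z - g z) \<in> bounded_holomorphic S (C + D)"
proof
  show "(\<lambda>z. f z - g z) holomorphic_on S"
    by (intro holomorphic_on_diff bounded_holomorphicD[OF assms(1)]
      bounded_holomorphicD[OF assms(2)])
  show "cmod (f z - g z) \<le> C + D" if "z \<in> S" for z
    using bounded_holomorphicD(2)[OF assms(1) that] bounded_holomorphicD(2)[OF assms(2) that]
      norm_triangle_ineq4[of "f z" "g z"] by linarith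
qed

lemma norm_higher_deriv_le:
  assumes g: "g \<in> bounded_holomorphic S C" and "cball z r \<subseteq> S" "0 < r"
  shows "cmod ((deriv ^^ j) g z) \<le> fact j * C / r ^ j"
proof (rule Cauchy_inequality)
  have "g holomorphic_on cball z r"
    using bounded_holomorphicD(1)[OF g] assms(2) by (rule holomorphic_on_subset)
  then show "g holomorphic_on ball z r" "continuous_on (cball z r) g"
    by (auto intro: holomorphic_on_subset holomorphic_on_imp_continuous_on)
  show "cmod (g w) \<le> C" if "cmod (z - w) = r" for w
    using that assms(2) by (intro bounded_holomorphicD(2)[OF g]) (auto simp: dist_norm subset_iff)
qed fact

lemma higher_derivs_uniformly_bounded:
  assumes "open S" "compact L" "L \<subseteq> S"
  obtains M where "0 \<le> M" "\<And>g i z. g \<in> bounded_holomorphic S C \<Longrightarrow> i \<le> n \<Longrightarrow> z \<in> L \<Longrightarrow>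
    cmod ((deriv ^^ i) g z) \<le> M"
proof -
  obtain r where r: "0 < r" "(\<Union>z\<in>L. cball z r) \<subseteq> S"
    using compact_subset_open_imp_cball_epsilon_subset[OF assms(2,1,3)] .
  let ?M = "Max (insert 0 ((\<lambda>i. fact i * C / r ^ i) ` {..n}))"
  show ?thesis
  proof (rule that[of ?M])
    show "0 \<le> ?M" by (intro Max_ge) auto
    fix g i z assume g: "g \<in> bounded_holomorphic S C" and "i \<le> n" and "z \<in> L"
    have "cmod ((deriv ^^ i) g z) \<le> fact i * C / r ^ i"
      using r \<open>z \<in> L\<close> by (intro norm_higher_deriv_le[OF g]) auto
    also have "\<dots> \<le> ?M"
      using \<open>i \<le> n\<close> by (intro Max_ge) auto
    finally show "cmod ((deriv ^^ i) g z) \<le> ?M" .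
  qed
qed

lemma uniform_limit_higher_deriv:
  assumes "open S" and f: "\<And>n. f n holomorphic_on S" and h: "h holomorphic_on S"
    and lim: "\<And>K. compact K \<Longrightarrow> K \<subseteq> S \<Longrightarrow> uniform_limit K f h F"
    and L: "compact L" "L \<subseteq> S"
  shows "uniform_limit L (\<lambda>n. (deriv ^^ j) (f n)) ((deriv ^^ j) h) F"
proof (rule uniform_limitI)
  fix e :: real assume "0 < e"
  obtain r where r: "0 < r" "(\<Union>z\<in>L. cball z r) \<subseteq> S"
    using compact_subset_open_imp_cball_epsilon_subset[OF L(1) \<open>open S\<close> L(2)] .
  define K where "K = (\<Union>z\<in>L. \<Union>w\<in>cball 0 r. {z + w})"
  have K_eq: "K = (\<Union>z\<in>L. cball z r)"
  proof -
    have "(\<Union>w\<in>cball 0 r. {z + w}) = cball z r" for z :: complex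
      using image_add_cball[of z 0 r] by (simp add: UNION_singleton_eq_range)
    then show ?thesis by (simp add: K_def)
  qed
  have "compact K"
    unfolding K_def using compact_sums'[OF L(1) compact_cball] by simp
  moreover have "K \<subseteq> S" using r by (simp add: K_eq)
  ultimately have "uniform_limit K f h F" by (rule lim)
  then have "\<forall>\<^sub>F n in F. \<forall>z\<in>K. dist (f n z) (h z) < e / 2 * r ^ j / fact j"
    by (rule uniform_limitD) (use \<open>0 < e\<close> r in simp)
  then show "\<forall>\<^sub>F n in F. \<forall>z\<in>L. dist ((deriv ^^ j) (f n) z) ((deriv ^^ j) h z) < e"
  proof (rule eventually_mono, intro ballI)
    fix n z assume close: "\<forall>z\<in>K. dist (f n z) (h z) < e / 2 * r ^ j / fact j" and "z \<in> L"
    have "(\<lambda>z. f n z - h z) \<in> bounded_holomorphic K (e / 2 * r ^ j / fact j)"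
      using close by (intro bounded_holomorphicI holomorphic_on_diff holomorphic_on_subset[OF f]
        holomorphic_on_subset[OF h] \<open>K \<subseteq> S\<close>) (auto simp: dist_norm)
    then have "cmod ((deriv ^^ j) (\<lambda>z. f n z - h z) z) \<le> fact j * (e / 2 * r ^ j / fact j) / r ^ j"
      using \<open>z \<in> L\<close> r by (intro norm_higher_deriv_le) (auto simp: K_eq)
    also have "(deriv ^^ j) (\<lambda>z. f n z - h z) z = (deriv ^^ j) (f n) z - (deriv ^^ j) h z"
      using \<open>z \<in> L\<close> L by (intro higher_deriv_diff[OF f h \<open>open S\<close>]) auto
    also have "fact j * (e / 2 * r ^ j / fact j) / r ^ j = e / 2" using r by simp
    finally show "dist ((deriv ^^ j) (f n) z) ((deriv ^^ j) h z) < e"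
      using \<open>0 < e\<close> by (simp add: dist_norm)
  qed
qed

lemma tendsto_uniform_limit_compose:
  assumes f: "uniform_limit L f h F" and h: "continuous_on L h"
    and x: "(x \<longlongrightarrow> l) F" "\<And>n. x n \<in> L" "l \<in> L"
  shows "((\<lambda>n. f n (x n)) \<longlongrightarrow> h l) F"
proof (rule tendstoI)
  fix e :: real assume "0 < e"
  have "((\<lambda>n. h (x n)) \<longlongrightarrow> h l) F"
    using x by (intro continuous_on_tendsto_compose[OF h]) auto
  then have "\<forall>\<^sub>F n in F. dist (h (x n)) (h l) < e / 2"
    using \<open>0 < e\<close> by (intro tendstoD) auto
  moreover have "\<forall>\<^sub>F n in F. \<forall>z\<in>L. dist (f n z) (h z) < e / 2"
    using \<open>0 < e\<close> by (intro uniform_limitD[OF f]) auto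
  ultimately show "\<forall>\<^sub>F n in F. dist (f n (x n)) (h l) < e"
    by eventually_elim (metis x(2) dist_commute dist_triangle_half_r)
qed

lemma bounded_holomorphic_subsequence_tends_to_zero:
  assumes S: "open S" "connected S" and L: "compact L" "L \<subseteq> S"
    and g: "\<And>n. g n \<in> bounded_holomorphic S C" and x: "\<And>n. x n \<in> L"
    and g_x: "\<And>j. (\<lambda>n. (deriv ^^ j) (g n) (x n)) \<longlonglongrightarrow> 0"
  obtains t where "strict_mono t"
    "\<And>K. compact K \<Longrightarrow> K \<subseteq> S \<Longrightarrow> uniform_limit K (\<lambda>n. g (t n)) (\<lambda>_. 0) sequentially"
proof -
  obtain l r where l: "l \<in> L" and r: "strict_mono r" "(x \<circ> r) \<longlonglongrightarrow> l"
    using L(1) x unfolding compact_def by blast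
  obtain h s where h: "h holomorphic_on S" and s: "strict_mono s"
    and lim: "\<And>K. compact K \<Longrightarrow> K \<subseteq> S \<Longrightarrow> uniform_limit K ((g \<circ> r) \<circ> s) h sequentially"
  proof (rule Montel[OF S(1), of "bounded_holomorphic S C" "g \<circ> r"])
    show "\<exists>B. \<forall>f\<in>bounded_holomorphic S C. \<forall>z\<in>K. cmod (f z) \<le> B" if "K \<subseteq> S" for K
      using that by (intro exI[of _ C]) (auto simp: bounded_holomorphic_def)
  qed (use g bounded_holomorphicD(1) in auto)
  define t where "t = r \<circ> s"
  have t: "strict_mono t" unfolding t_def using r(1) s by (rule strict_mono_o)
  have x_lim: "(\<lambda>n. x (t n)) \<longlonglongrightarrow> l"
    using LIMSEQ_subseq_LIMSEQ[OF r(2) s] by (simp add: t_def o_def)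
  have lim: "uniform_limit K (\<lambda>n. g (t n)) h sequentially" if "compact K" "K \<subseteq> S" for K
    using lim[OF that] by (simp add: t_def o_def)
  have "(deriv ^^ j) h l = 0" for j
  proof (rule LIMSEQ_unique)
    show "(\<lambda>n. (deriv ^^ j) (g (t n)) (x (t n))) \<longlonglongrightarrow> (deriv ^^ j) h l"
    proof (rule tendsto_uniform_limit_compose[OF _ _ x_lim x l])
      show "uniform_limit L (\<lambda>n. (deriv ^^ j) (g (t n))) ((deriv ^^ j) h) sequentially"
        by (rule uniform_limit_higher_deriv[OF S(1) bounded_holomorphicD(1)[OF g] h lim L])
      show "continuous_on L ((deriv ^^ j) h)"
        by (intro holomorphic_on_imp_continuous_on holomorphic_on_subset[OF _ L(2)]
            holomorphic_higher_deriv h S(1))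
    qed
    show "(\<lambda>n. (deriv ^^ j) (g (t n)) (x (t n))) \<longlonglongrightarrow> 0"
      using LIMSEQ_subseq_LIMSEQ[OF g_x t] by (simp add: o_def)
  qed
  then have h_zero: "h z = 0" if "z \<in> S" for z
    using holomorphic_fun_eq_0_on_connected[OF h S, of l z] l L(2) that by blast
  show ?thesis
  proof (rule that[OF t])
    show "uniform_limit K (\<lambda>n. g (t n)) (\<lambda>_. 0) sequentially" if "compact K" "K \<subseteq> S" for K
      using lim[OF that] h_zero that(2) by (simp add: uniform_limit_iff subset_iff cong: ball_cong)
  qed
qed

lemma higher_deriv_lower_bound_by_normality:
  assumes S: "open S" "connected S" and K: "compact K" "K \<subseteq> S" and L: "compact L" "L \<subseteq> S"
    and "0 < \<delta>"
  obtains \<eta> n where "0 < \<eta>"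
    "\<And>g x. g \<in> bounded_holomorphic S C \<Longrightarrow> \<exists>z\<in>K. \<delta> \<le> cmod (g z) \<Longrightarrow> x \<in> L \<Longrightarrow>
      \<exists>j\<le>n. \<eta> \<le> cmod ((deriv ^^ j) g x)"
proof (rule ccontr)
  assume contr: "\<not> thesis"
  define P where "P n g x \<longleftrightarrow> g \<in> bounded_holomorphic S C \<and> (\<exists>z\<in>K. \<delta> \<le> cmod (g z)) \<and> x \<in> L \<and>
      (\<forall>j\<le>n. cmod ((deriv ^^ j) g x) < inverse (real (Suc n)))" for n g x
  have "\<exists>g x. P n g x" for n
  proof (rule ccontr)
    assume "\<nexists>g x. P n g x"
    then have "thesis"
      by (intro that[of "inverse (real (Suc n))" n]) (auto simp: P_def not_less)
    with contr show False ..
  qed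
  then obtain g x where P: "\<And>n. P n (g n) (x n)" by metis
  have g: "g n \<in> bounded_holomorphic S C" "\<exists>z\<in>K. \<delta> \<le> cmod (g n z)" and x: "x n \<in> L"
    and small: "j \<le> n \<Longrightarrow> cmod ((deriv ^^ j) (g n) (x n)) \<le> inverse (real (Suc n))" for n j
    using P[of n] by (simp_all add: P_def less_imp_le)
  have g_x: "(\<lambda>n. (deriv ^^ j) (g n) (x n)) \<longlonglongrightarrow> 0" for j
    by (rule Lim_null_comparison[OF eventually_sequentiallyI[OF small] LIMSEQ_inverse_real_of_nat])
  obtain t where t: "\<And>K. compact K \<Longrightarrow> K \<subseteq> S \<Longrightarrow>
      uniform_limit K (\<lambda>n. g (t n)) (\<lambda>_. 0) sequentially"
    by (rule bounded_holomorphic_subsequence_tends_to_zero[OF S L g(1) x g_x]) blast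
  obtain n where "\<And>z. z \<in> K \<Longrightarrow> cmod (g (t n) z) < \<delta>"
    using uniform_limitD[OF t[OF K] \<open>0 < \<delta>\<close>] by (auto simp: eventually_sequentially)
  then show False using g(2)[of "t n"] by force
qed

abbreviation unit_seg :: "complex set" where
  "unit_seg \<equiv> complex_of_real ` {0..1}"

lemma compact_unit_seg: "compact unit_seg"
  by (intro compact_continuous_image continuous_intros) auto

lemma holomorphic_Landau_lower_bound:
  fixes a b l x :: real
  assumes "open S" "unit_seg \<subseteq> S" and g: "g holomorphic_on S"
    and M: "\<And>i z. i \<le> Suc n \<Longrightarrow> z \<in> unit_seg \<Longrightarrow> cmod ((deriv ^^ i) g z) \<le> M"
    and "j \<le> n" and ab: "0 \<le> a" "b \<le> 1" and l: "0 < l" "l \<le> b - a"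
    and \<kappa>: "0 < \<kappa>" "\<kappa> \<le> 1" and x: "x \<in> {a..b}" "\<kappa> \<le> cmod ((deriv ^^ j) g (of_real x))"
  shows "\<exists>y\<in>{a..b}. (\<kappa> * (l / (4 + M))) ^ 4 ^ n \<le> cmod (g (of_real y))"
proof -
  have "0 \<le> M" using M[of 0 0] by (force intro: order_trans[OF norm_ge_zero])
  define \<theta> where "\<theta> = l / (4 + M)"
  have \<theta>: "0 < \<theta>" "(4 + M) * \<theta> \<le> b - a" "\<theta> \<le> 1"
    using l ab \<open>0 \<le> M\<close> by (simp_all add: \<theta>_def divide_le_eq)
  have "\<exists>y\<in>{a..b}. (\<kappa> * \<theta>) ^ 4 ^ j \<le> cmod ((deriv ^^ 0) g (of_real y))"
  proof (rule iterated_Landau_lower_bound[where f = "\<lambda>i t. (deriv ^^ i) g (of_real t)"])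
    fix i t assume "t \<in> {a..b}"
    then have t: "complex_of_real t \<in> unit_seg" using ab by simp
    show "((\<lambda>t. (deriv ^^ i) g (of_real t)) has_vector_derivative (deriv ^^ Suc i) g (of_real t))
        (at t within {a..b})"
      using t assms(2)
      by (intro has_vector_derivative_real_field
        has_field_derivative_higher_deriv[OF g \<open>open S\<close>]) auto
    show "cmod ((deriv ^^ i) g (of_real t)) \<le> M" if "i \<le> Suc j"
      using M[OF _ t, of i] that \<open>j \<le> n\<close> by simp
  qed (use \<theta> \<kappa> x ab in auto)
  moreover have "(\<kappa> * \<theta>) ^ 4 ^ n \<le> (\<kappa> * \<theta>) ^ 4 ^ j"
    using \<kappa> \<theta> \<open>j \<le> n\<close> by (intro power_decreasing power_increasing mult_le_one) auto
  ultimately show ?thesis by (fastforce simp: \<theta>_def intro: order_trans)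
qed

definition large_on_subintervals :: "real \<Rightarrow> nat \<Rightarrow> (complex \<Rightarrow> complex) \<Rightarrow> bool" where
  "large_on_subintervals c E g \<longleftrightarrow> (\<forall>a b l. 0 \<le> a \<longrightarrow> b \<le> 1 \<longrightarrow> 0 < l \<longrightarrow> l \<le> b - a \<longrightarrow>
    (\<exists>x\<in>{a..b}. (c * l) ^ E \<le> cmod (g (of_real x))))"

lemma large_on_subintervalsD:
  fixes a b l :: real
  assumes "large_on_subintervals c E g" "0 \<le> a" "b \<le> 1" "0 < l" "l \<le> b - a"
  obtains x where "x \<in> {a..b}" "(c * l) ^ E \<le> cmod (g (of_real x))"
  using assms unfolding large_on_subintervals_def by blast

lemma large_on_subintervals_by_normality:
  assumes S: "open S" "connected S" "unit_seg \<subseteq> S" and K: "compact K" "K \<subseteq> S" and "0 < \<delta>"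
  obtains c E where "0 < c" "c \<le> 1"
    "\<And>g. g \<in> bounded_holomorphic S C \<Longrightarrow> \<exists>z\<in>K. \<delta> \<le> cmod (g z) \<Longrightarrow> large_on_subintervals c E g"
proof -
  obtain \<eta> n where "0 < \<eta>" and n: "\<And>g z. g \<in> bounded_holomorphic S C \<Longrightarrow>
      \<exists>z\<in>K. \<delta> \<le> cmod (g z) \<Longrightarrow> z \<in> unit_seg \<Longrightarrow> \<exists>j\<le>n. \<eta> \<le> cmod ((deriv ^^ j) g z)"
    by (rule higher_deriv_lower_bound_by_normality[OF S(1,2) K compact_unit_seg S(3) \<open>0 < \<delta>\<close>]) blast
  obtain M where "0 \<le> M" and M: "\<And>g i z. g \<in> bounded_holomorphic S C \<Longrightarrow> i \<le> Suc n \<Longrightarrow>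
      z \<in> unit_seg \<Longrightarrow> cmod ((deriv ^^ i) g z) \<le> M"
    by (rule higher_derivs_uniformly_bounded[OF S(1) compact_unit_seg S(3)]) blast
  define \<kappa> where "\<kappa> = min \<eta> 1"
  have \<kappa>: "0 < \<kappa>" "\<kappa> \<le> 1" "\<kappa> \<le> \<eta>" using \<open>0 < \<eta>\<close> by (auto simp: \<kappa>_def)
  show ?thesis
  proof (rule that)
    show "0 < \<kappa> / (4 + M)" "\<kappa> / (4 + M) \<le> 1" using \<kappa> \<open>0 \<le> M\<close> by (auto simp: divide_le_eq)
    fix g assume g: "g \<in> bounded_holomorphic S C" "\<exists>z\<in>K. \<delta> \<le> cmod (g z)"
    show "large_on_subintervals (\<kappa> / (4 + M)) (4 ^ n) g"
      unfolding large_on_subintervals_def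
    proof (intro allI impI)
      fix a b l :: real assume ab: "0 \<le> a" "b \<le> 1" and l: "0 < l" "l \<le> b - a"
      have "complex_of_real a \<in> unit_seg" using ab l by simp
      then obtain j where j: "j \<le> n" "\<eta> \<le> cmod ((deriv ^^ j) g (of_real a))"
        using n[OF g] by blast
      show "\<exists>x\<in>{a..b}. (\<kappa> / (4 + M) * l) ^ 4 ^ n \<le> cmod (g (of_real x))"
        using holomorphic_Landau_lower_bound[OF S(1,3) bounded_holomorphicD(1)[OF g(1)] M[OF g(1)]
            j(1) ab l \<kappa>(1,2), of a] j(2) \<kappa>(3) l by simp
    qed
  qed
qed

section \<open>Real functions with a complex extension\<close>

definition complexification_on :: "complex set \<Rightarrow> (real \<Rightarrow> real) \<Rightarrow> (complex \<Rightarrow> complex) \<Rightarrow> bool" where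
  "complexification_on S f F \<longleftrightarrow>
    F holomorphic_on S \<and> (\<forall>x. of_real x \<in> S \<longrightarrow> F (of_real x) = of_real (f x))"

lemma complexification_onD:
  assumes "complexification_on S f F"
  shows "F holomorphic_on S" "of_real x \<in> S \<Longrightarrow> F (of_real x) = of_real (f x)"
  using assms by (simp_all add: complexification_on_def)

lemma complexification_on_subset:
  "complexification_on S f F \<Longrightarrow> T \<subseteq> S \<Longrightarrow> complexification_on T f F"
  unfolding complexification_on_def by (blast intro: holomorphic_on_subset)

lemma complexification_on_compose:
  assumes "complexification_on S f F" "complexification_on T g G" "F ` S \<subseteq> T"
  shows "complexification_on S (g \<circ> f) (G \<circ> F)"
  using assms unfolding complexification_on_def
  by (auto intro: holomorphic_on_compose_gen)

lemma complexification_on_fold: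
  assumes "\<And>i. i \<in> I \<Longrightarrow> complexification_on S (f i) (F i)" "\<And>i. i \<in> I \<Longrightarrow> F i ` S \<subseteq> S"
  shows "set w \<subseteq> I \<Longrightarrow> complexification_on S (fold f w) (fold F w)"
proof (induction w)
  case Nil
  then show ?case by (simp add: complexification_on_def id_def)
next
  case (Cons i w)
  then show ?case
    unfolding fold_Cons by (intro complexification_on_compose[where T = S] assms) auto
qed

lemma complexification_on_add_cmult:
  assumes "complexification_on S f F" "complexification_on S g G"
  shows "complexification_on S (\<lambda>x. f x + c * g x) (\<lambda>z. F z + of_real c * G z)"
  using assms unfolding complexification_on_def by (auto intro!: holomorphic_intros)

lemma complexification_on_has_real_derivative:
  assumes "open S" and F: "complexification_on S f F" and x: "of_real x \<in> S"
  shows "(f has_real_derivative Re (deriv F (of_real x))) (at x)" "Im (deriv F (of_real x)) = 0"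
proof -
  let ?D = "deriv F (of_real x)"
  have "open (complex_of_real -` S)"
    using \<open>open S\<close> by (intro open_vimage continuous_intros)
  then have "\<forall>\<^sub>F y in nhds x. F (of_real y) = of_real (f y)"
    using eventually_nhds_in_open[of "complex_of_real -` S" x] x complexification_onD(2)[OF F]
    by (auto elim: eventually_mono)
  moreover have "((\<lambda>y. F (of_real y)) has_vector_derivative ?D) (at x)"
    using holomorphic_derivI[OF complexification_onD(1)[OF F] \<open>open S\<close> x]
    by (rule has_vector_derivative_real_field)
  ultimately have D: "((\<lambda>y. complex_of_real (f y)) has_vector_derivative ?D) (at x)"
    using has_vector_derivative_cong_ev[of UNIV "\<lambda>y. F (of_real y)" "\<lambda>y. of_real (f y)" x ?D]
      complexification_onD(2)[OF F x] by simp
  show "(f has_real_derivative Re ?D) (at x)"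
    using bounded_linear.has_vector_derivative[OF bounded_linear_Re D]
    by (simp add: has_real_derivative_iff_has_vector_derivative)
  have "((\<lambda>y. 0) has_real_derivative Im ?D) (at x)"
    using bounded_linear.has_vector_derivative[OF bounded_linear_Im D]
    by (simp add: has_real_derivative_iff_has_vector_derivative)
  then show "Im ?D = 0" using DERIV_unique DERIV_const by blast
qed

lemma complexification_on_deriv:
  assumes "open S" and F: "complexification_on S f F"
  shows "complexification_on S (deriv f) (deriv F)"
  unfolding complexification_on_def
proof (intro conjI allI impI)
  show "deriv F holomorphic_on S"
    using complexification_onD(1)[OF F] \<open>open S\<close> by (rule holomorphic_deriv)
  show "deriv F (of_real x) = of_real (deriv f x)" if "of_real x \<in> S" for x
    using complexification_on_has_real_derivative[OF assms that]
    by (simp add: DERIV_imp_deriv complex_eq_iff)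
qed

lemma complexification_on_higher_deriv:
  "open S \<Longrightarrow> complexification_on S f F \<Longrightarrow> complexification_on S ((deriv ^^ j) f) ((deriv ^^ j) F)"
  by (induction j) (auto intro: complexification_on_deriv)

lemma complexification_on_continuous:
  assumes "complexification_on S f F" "of_real ` X \<subseteq> S"
  shows "continuous_on X f"
proof -
  have "continuous_on X (\<lambda>x. F (of_real x))"
    using holomorphic_on_imp_continuous_on[OF complexification_onD(1)[OF assms(1)]] assms(2)
    by (rule continuous_on_compose2[OF _ continuous_on_of_real[OF continuous_on_id]])
  then have "continuous_on X (\<lambda>x. Re (F (of_real x)))" by (intro continuous_intros)
  then show ?thesis
    by (rule continuous_on_eq) (use assms complexification_onD(2) in fastforce)
qed

lemma complexification_on_expansion:
  fixes a b x y m :: real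
  assumes "open S" and F: "complexification_on S f F" and "of_real ` {a..b} \<subseteq> S"
    and m: "\<And>x. x \<in> {a..b} \<Longrightarrow> m \<le> cmod (deriv F (of_real x))"
    and xy: "x \<in> {a..b}" "y \<in> {a..b}"
  shows "m * \<bar>x - y\<bar> \<le> \<bar>f x - f y\<bar>"
proof -
  have "m * (v - u) \<le> \<bar>f v - f u\<bar>" if uv: "a \<le> u" "u < v" "v \<le> b" for u v
  proof -
    have f: "(f has_real_derivative deriv f t) (at t)" "m \<le> \<bar>deriv f t\<bar>" if "u \<le> t" "t \<le> v" for t
    proof -
      have "t \<in> {a..b}" using uv that by auto
      then have t: "of_real t \<in> S" using assms(3) by blast
      show "(f has_real_derivative deriv f t) (at t)"
        using complexification_on_has_real_derivative(1)[OF \<open>open S\<close> F t] DERIV_imp_deriv by metis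
      show "m \<le> \<bar>deriv f t\<bar>"
        using m[OF \<open>t \<in> {a..b}\<close>]
          complexification_onD(2)[OF complexification_on_deriv[OF \<open>open S\<close> F] t]
        by simp
    qed
    obtain t where t: "u < t" "t < v" "f v - f u = (v - u) * deriv f t"
      using MVT2[OF uv(2) f(1)] by blast
    then show ?thesis
      using f(2)[of t] uv(2) by (simp add: abs_mult mult.commute)
  qed
  from this[of x y] this[of y x] show ?thesis
    using xy by (cases x y rule: linorder_cases) auto
qed

lemma complexification_on_image_interval:
  fixes a b m :: real
  assumes "open S" and F: "complexification_on S f F" and "of_real ` {a..b} \<subseteq> S"
    and "0 < m" and m: "\<And>x. x \<in> {a..b} \<Longrightarrow> m \<le> cmod (deriv F (of_real x))" and "a \<le> b"
  shows "f ` {a..b} = closed_segment (f a) (f b)"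
proof -
  have "inj_on f {a..b}"
  proof (rule inj_onI)
    fix x y :: real assume xy: "x \<in> {a..b}" "y \<in> {a..b}" "f x = f y"
    then have "m * \<bar>x - y\<bar> \<le> 0"
      using complexification_on_expansion[OF \<open>open S\<close> F assms(3) m xy(1,2)] by simp
    then show "x = y" using \<open>0 < m\<close> by (simp add: mult_le_0_iff)
  qed
  then show ?thesis
    using continuous_injective_image_segment_1[of a b f]
      complexification_on_continuous[OF F assms(3)]
      \<open>a \<le> b\<close> by (simp add: closed_segment_eq_real_ivl)
qed

section \<open>Neighbourhoods of the unit interval\<close>

lemma B_nbhd_eq_infdist: "B_nbhd \<rho> = {z. infdist z unit_seg < \<rho>}"
proof (intro equalityI subsetI CollectI)
  fix z assume "z \<in> B_nbhd \<rho>"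
  then obtain x where x: "x \<in> unit_seg" "dist z x < \<rho>"
    by (auto simp: B_nbhd_def dist_norm)
  then show "infdist z unit_seg < \<rho>"
    using infdist_le[OF x(1), of z] by simp
next
  fix z assume "z \<in> {z. infdist z unit_seg < \<rho>}"
  moreover obtain x where "x \<in> unit_seg" "infdist z unit_seg = dist z x"
    using infdist_attains_inf[of unit_seg z] compact_unit_seg by (auto dest: compact_imp_closed)
  ultimately show "z \<in> B_nbhd \<rho>"
    by (auto simp: B_nbhd_def dist_norm)
qed

lemma open_B_nbhd: "open (B_nbhd \<rho>)"
  unfolding B_nbhd_eq_infdist by (intro open_Collect_less continuous_intros)

lemma B_nbhd_mono: "\<rho> \<le> \<rho>' \<Longrightarrow> B_nbhd \<rho> \<subseteq> B_nbhd \<rho>'"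
  unfolding B_nbhd_eq_infdist by auto

lemma unit_seg_subset_B_nbhd: "0 < \<rho> \<Longrightarrow> unit_seg \<subseteq> B_nbhd \<rho>"
  unfolding B_nbhd_eq_infdist by auto

lemma closure_B_nbhd_subset_B_nbhd:
  assumes "\<rho> < \<rho>'"
  shows "closure (B_nbhd \<rho>) \<subseteq> B_nbhd \<rho>'"
proof -
  have "closure (B_nbhd \<rho>) \<subseteq> {z. infdist z unit_seg \<le> \<rho>}"
    by (intro closure_minimal closed_Collect_le continuous_intros) (auto simp: B_nbhd_eq_infdist)
  then show ?thesis using \<open>\<rho> < \<rho>'\<close> by (auto simp: B_nbhd_eq_infdist)
qed

lemma cball_subset_B_nbhd: "z \<in> B_nbhd \<rho> \<Longrightarrow> cball z r \<subseteq> B_nbhd (\<rho> + r)"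
proof
  fix w assume "z \<in> B_nbhd \<rho>" "w \<in> cball z r"
  then show "w \<in> B_nbhd (\<rho> + r)"
    using infdist_triangle[of w unit_seg z] by (simp add: B_nbhd_eq_infdist dist_commute)
qed

lemma norm_less_if_in_B_nbhd:
  assumes "z \<in> B_nbhd \<rho>"
  shows "cmod z < 1 + \<rho>"
proof -
  obtain x where "x \<in> {0..1}" "cmod (z - of_real x) < \<rho>"
    using assms by (auto simp: B_nbhd_def)
  then show ?thesis
    using norm_triangle_sub[of z "of_real x"] by auto
qed

lemma norm_le_if_in_closure_B_nbhd:
  assumes "z \<in> closure (B_nbhd \<rho>)"
  shows "cmod z \<le> 1 + \<rho>"
proof -
  have "closure (B_nbhd \<rho>) \<subseteq> cball 0 (1 + \<rho>)"
    by (rule closure_minimal) (auto dest: norm_less_if_in_B_nbhd)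
  with assms show ?thesis by auto
qed

lemma compact_closure_B_nbhd: "compact (closure (B_nbhd \<rho>))"
  unfolding compact_closure bounded_iff using norm_less_if_in_B_nbhd less_imp_le by blast

lemma convex_unit_seg: "convex unit_seg"
  by (intro convex_linear_image bounded_linear.linear bounded_linear_of_real) auto

lemma connected_B_nbhd: "connected (B_nbhd \<rho>)"
proof -
  have "B_nbhd \<rho> = (\<Union>x\<in>unit_seg. \<Union>y\<in>ball 0 \<rho>. {x + y})"
  proof -
    have "(\<Union>y\<in>ball 0 \<rho>. {x + y}) = ball x \<rho>" for x :: complex
      using image_add_ball[of x 0 \<rho>] by (simp add: UNION_singleton_eq_range)
    then show ?thesis by (auto simp: B_nbhd_def dist_norm norm_minus_commute)
  qed
  then show ?thesis
    using convex_sums[OF convex_unit_seg convex_ball] by (simp add: convex_connected)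
qed

lemma lipschitz_on_unit_seg:
  assumes "0 < \<rho>" and g: "g \<in> bounded_holomorphic (B_nbhd \<rho>) C"
  shows "(2 * C / \<rho>)-lipschitz_on unit_seg g"
proof (rule lipschitz_onI)
  have g': "cmod (deriv g z) \<le> 2 * C / \<rho>" if "z \<in> unit_seg" for z
  proof -
    have "cball z (\<rho> / 2) \<subseteq> B_nbhd \<rho>"
      using cball_subset_B_nbhd[of z "\<rho> / 2" "\<rho> / 2"] unit_seg_subset_B_nbhd[of "\<rho> / 2"]
        that \<open>0 < \<rho>\<close>
      by auto
    from norm_higher_deriv_le[OF g this, of 1] show ?thesis
      using \<open>0 < \<rho>\<close> by (simp add: mult.commute)
  qed
  show "dist (g z) (g w) \<le> 2 * C / \<rho> * dist z w" if "z \<in> unit_seg" "w \<in> unit_seg" for z w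
    unfolding dist_norm
  proof (rule field_differentiable_bound[OF convex_unit_seg _ g' that])
    show "(g has_field_derivative deriv g z) (at z within unit_seg)" if "z \<in> unit_seg" for z
    proof (rule holomorphic_derivI[OF bounded_holomorphicD(1)[OF g] open_B_nbhd])
      show "z \<in> B_nbhd \<rho>" using that unit_seg_subset_B_nbhd[OF \<open>0 < \<rho>\<close>] by blast
    qed
  qed
  show "0 \<le> 2 * C / \<rho>"
    using g'[of 0] by (force intro: order_trans[OF norm_ge_zero])
qed

section \<open>Nonlinearity of compositions\<close>

definition nonlin :: "(complex \<Rightarrow> complex) \<Rightarrow> complex \<Rightarrow> complex" where
  "nonlin f z = (deriv ^^ 2) f z / deriv f z"

lemma holomorphic_nonlin:
  assumes "f holomorphic_on S" "open S" "\<And>z. z \<in> S \<Longrightarrow> deriv f z \<noteq> 0"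
  shows "nonlin f holomorphic_on S"
  unfolding nonlin_def[abs_def] using assms
  by (intro holomorphic_on_divide holomorphic_higher_deriv holomorphic_deriv)

lemma nonlin_id [simp]: "nonlin id z = 0"
  by (simp add: nonlin_def numeral_2_eq_2)

lemma nonlin_compose:
  assumes S: "open S" "f holomorphic_on S" "z \<in> S" and T: "open T" "g holomorphic_on T"
    and "f ` S \<subseteq> T" and nz: "deriv f z \<noteq> 0" "deriv g (f z) \<noteq> 0"
  shows "nonlin (g \<circ> f) z = nonlin f z + deriv f z * nonlin g (f z)"
proof -
  have f: "f field_differentiable at w" "deriv f field_differentiable at w" if "w \<in> S" for w
    using S(1,2) holomorphic_deriv that by (blast intro: holomorphic_on_imp_differentiable_at)+
  have g: "g field_differentiable at (f w)" "deriv g field_differentiable at (f w)" if "w \<in> S" for w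
    using T holomorphic_deriv that assms(6) by (blast intro: holomorphic_on_imp_differentiable_at)+
  have chain: "deriv (g \<circ> f) w = deriv g (f w) * deriv f w" if "w \<in> S" for w
    using f g that by (intro deriv_chain) auto
  have deriv2: "(deriv ^^ 2) h = deriv (deriv h)" for h :: "complex \<Rightarrow> complex"
    by (simp add: numeral_2_eq_2)
  have "\<forall>\<^sub>F w in nhds z. deriv (g \<circ> f) w = (deriv g \<circ> f) w * deriv f w"
    using eventually_nhds_in_open[OF S(1,3)] by (rule eventually_mono) (simp add: chain)
  then have "(deriv ^^ 2) (g \<circ> f) z = deriv (\<lambda>w. (deriv g \<circ> f) w * deriv f w) z"
    unfolding deriv2 by (intro deriv_cong_ev) auto
  also have "\<dots> = deriv g (f z) * (deriv ^^ 2) f z + (deriv ^^ 2) g (f z) * (deriv f z)\<^sup>2"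
    using f[OF S(3)] g[OF S(3)]
    by (simp add: deriv2 deriv_chain field_differentiable_compose power2_eq_square
        del: o_apply) simp
  finally show ?thesis
    using nz by (simp add: nonlin_def chain[OF S(3)] field_simps power2_eq_square)
qed

lemma norm_nonlin_diff_times_deriv_le:
  assumes "open S" "f holomorphic_on S" "g holomorphic_on S" "z \<in> S"
    and nz: "deriv f z \<noteq> 0" "deriv g z \<noteq> 0"
  defines "h \<equiv> \<lambda>w. f w - g w"
  shows "cmod (deriv f z) * cmod (nonlin f z - nonlin g z)
    \<le> cmod ((deriv ^^ 2) h z) + cmod (nonlin g z) * cmod (deriv h z)"
proof -
  have h: "(deriv ^^ j) h z = (deriv ^^ j) f z - (deriv ^^ j) g z" for j
    unfolding h_def by (intro higher_deriv_diff[OF assms(2,3,1,4)])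
  have "deriv h z = deriv f z - deriv g z" using h[of 1] by simp
  then have "deriv f z * (nonlin f z - nonlin g z) = (deriv ^^ 2) h z - nonlin g z * deriv h z"
    using nz by (simp add: h nonlin_def diff_divide_distrib right_diff_distrib left_diff_distrib)
  then show ?thesis
    using norm_triangle_ineq4[of "(deriv ^^ 2) h z" "nonlin g z * deriv h z"]
    by (simp only: norm_mult[symmetric])
qed

lemma fold_mem:
  "(\<And>i. i \<in> I \<Longrightarrow> f i ` X \<subseteq> X) \<Longrightarrow> set w \<subseteq> I \<Longrightarrow> x \<in> X \<Longrightarrow> fold f w x \<in> X"
  by (induction w arbitrary: x) auto

lemma norm_mult_mono:
  fixes x y :: "'a::real_normed_algebra"
  shows "norm x \<le> a \<Longrightarrow> norm y \<le> b \<Longrightarrow> norm (x * y) \<le> a * b"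
  by (meson mult_mono norm_ge_zero norm_mult_ineq order_trans)

text \<open>A word \<open>w\<close> acts by \<open>fold F w\<close>, that is, with the innermost map first; \<open>comp_word\<close> reads words
  in the opposite direction.\<close>

locale conformal_ifs =
  fixes S :: "complex set" and I :: "'i set" and F :: "'i \<Rightarrow> complex \<Rightarrow> complex"
  assumes open_domain: "open S"
    and holomorphic: "i \<in> I \<Longrightarrow> F i holomorphic_on S"
    and maps_domain: "i \<in> I \<Longrightarrow> F i ` S \<subseteq> S"
    and deriv_nonzero: "i \<in> I \<Longrightarrow> z \<in> S \<Longrightarrow> deriv (F i) z \<noteq> 0"
begin

lemma fold_in_domain: "set w \<subseteq> I \<Longrightarrow> z \<in> S \<Longrightarrow> fold F w z \<in> S"
  using fold_mem maps_domain by metis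

lemma holomorphic_fold: "set w \<subseteq> I \<Longrightarrow> fold F w holomorphic_on S"
proof (induction w)
  case (Cons i w)
  then show ?case
    unfolding fold_Cons
    by (intro holomorphic_on_compose_gen[of _ _ _ S] holomorphic maps_domain) auto
qed (simp add: id_def)

lemma deriv_fold_Cons:
  assumes "set (i # w) \<subseteq> I" "z \<in> S"
  shows "deriv (fold F (i # w)) z = deriv (fold F w) (F i z) * deriv (F i) z"
proof -
  have "F i field_differentiable at z"
    using assms holomorphic open_domain by (auto intro: holomorphic_on_imp_differentiable_at)
  moreover have "fold F w field_differentiable at (F i z)"
    using assms holomorphic_fold open_domain maps_domain
    by (intro holomorphic_on_imp_differentiable_at[of _ S]) auto
  ultimately show ?thesis unfolding fold_Cons by (rule deriv_chain)
qed

lemma deriv_fold_nonzero: "set w \<subseteq> I \<Longrightarrow> z \<in> S \<Longrightarrow> deriv (fold F w) z \<noteq> 0"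
proof (induction w arbitrary: z)
  case (Cons i w)
  then have "F i z \<in> S" using maps_domain by auto
  then show ?case
    using Cons deriv_nonzero unfolding deriv_fold_Cons[OF Cons.prems] by simp
qed (simp add: id_def)

lemma deriv_fold_lower_bound:
  assumes "0 \<le> m" and m: "\<And>i z. i \<in> I \<Longrightarrow> z \<in> S \<Longrightarrow> m \<le> cmod (deriv (F i) z)"
  shows "set w \<subseteq> I \<Longrightarrow> z \<in> S \<Longrightarrow> m ^ length w \<le> cmod (deriv (fold F w) z)"
proof (induction w arbitrary: z)
  case (Cons i w)
  then have "F i z \<in> S" using maps_domain by auto
  then have "m ^ length w * m \<le> cmod (deriv (fold F w) (F i z)) * cmod (deriv (F i) z)"
    using Cons m \<open>0 \<le> m\<close> by (intro mult_mono) auto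
  then show ?case
    unfolding deriv_fold_Cons[OF Cons.prems] by (simp add: norm_mult mult.commute)
qed (simp add: id_def)

lemma holomorphic_nonlin_fold: "set w \<subseteq> I \<Longrightarrow> nonlin (fold F w) holomorphic_on S"
  by (intro holomorphic_nonlin holomorphic_fold open_domain deriv_fold_nonzero)

lemma nonlin_fold_Cons:
  assumes "set (i # w) \<subseteq> I" "z \<in> S"
  shows "nonlin (fold F (i # w)) z = nonlin (F i) z + deriv (F i) z * nonlin (fold F w) (F i z)"
proof -
  have "F i z \<in> S" using assms maps_domain by auto
  then show ?thesis
    using assms nonlin_compose[of S "F i" z S "fold F w"]
    by (simp add: open_domain holomorphic holomorphic_fold maps_domain deriv_nonzero
      deriv_fold_nonzero)
qed

lemma norm_nonlin_fold_le:
  assumes X: "X \<subseteq> S" "\<And>i. i \<in> I \<Longrightarrow> F i ` X \<subseteq> X" and "q < 1" "0 \<le> A"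
    and F': "\<And>i z. i \<in> I \<Longrightarrow> z \<in> X \<Longrightarrow> cmod (deriv (F i) z) \<le> q"
    and nonlin: "\<And>i z. i \<in> I \<Longrightarrow> z \<in> X \<Longrightarrow> cmod (nonlin (F i) z) \<le> A"
  shows "set w \<subseteq> I \<Longrightarrow> z \<in> X \<Longrightarrow> cmod (nonlin (fold F w) z) \<le> A / (1 - q)"
proof (induction w arbitrary: z)
  case Nil
  then show ?case using \<open>q < 1\<close> \<open>0 \<le> A\<close> by (simp add: fold_Nil del: id_apply)
next
  case (Cons i w)
  have "0 \<le> q" using Cons.prems order_trans[OF norm_ge_zero F'] by auto
  have "cmod (nonlin (fold F (i # w)) z)
      \<le> cmod (nonlin (F i) z) + cmod (deriv (F i) z) * cmod (nonlin (fold F w) (F i z))"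
    using Cons.prems X(1) nonlin_fold_Cons[of i w z]
    by (metis norm_mult norm_triangle_ineq subsetD)
  also have "\<dots> \<le> A + q * (A / (1 - q))"
    using Cons X(2) F' nonlin \<open>0 \<le> q\<close> by (intro add_mono mult_mono) auto
  also have "\<dots> = A / (1 - q)" using \<open>q < 1\<close> by (simp add: field_simps)
  finally show ?case .
qed

lemma norm_nonlin_fold_diff_le:
  assumes G: "conformal_ifs S I G"
    and X: "X \<subseteq> S" "\<And>i. i \<in> I \<Longrightarrow> F i ` X \<subseteq> X" "\<And>i. i \<in> I \<Longrightarrow> G i ` X \<subseteq> X"
    and G': "q < 1" "\<And>i z. i \<in> I \<Longrightarrow> z \<in> X \<Longrightarrow> cmod (deriv (G i) z) \<le> q"
    and A: "\<And>w z. set w \<subseteq> I \<Longrightarrow> z \<in> X \<Longrightarrow> cmod (nonlin (fold F w) z) \<le> A"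
    and L: "\<And>w. set w \<subseteq> I \<Longrightarrow> L-lipschitz_on X (nonlin (fold F w))"
    and r: "0 \<le> r" "\<And>i z. i \<in> I \<Longrightarrow> z \<in> X \<Longrightarrow> cmod (F i z - G i z) \<le> r"
      "\<And>i z. i \<in> I \<Longrightarrow> z \<in> X \<Longrightarrow> cmod (deriv (F i) z - deriv (G i) z) \<le> r"
    and B: "0 \<le> B" "\<And>i z. i \<in> I \<Longrightarrow> z \<in> X \<Longrightarrow> cmod (nonlin (F i) z - nonlin (G i) z) \<le> B * r"
  shows "set w \<subseteq> I \<Longrightarrow> z \<in> X \<Longrightarrow>
    cmod (nonlin (fold F w) z - nonlin (fold G w) z) \<le> (A + L + B) / (1 - q) * r"
proof (induction w arbitrary: z)
  case Nil
  have "0 \<le> A" using order_trans[OF norm_ge_zero A[of "[]" z]] Nil by simp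
  moreover have "0 \<le> L" using lipschitz_on_nonneg[OF L[of "[]"]] by simp
  ultimately show ?case using r(1) B(1) G'(1) by simp
next
  case (Cons i w)
  interpret G: conformal_ifs S I G by (fact G)
  have i: "i \<in> I" and w: "set w \<subseteq> I" and z: "z \<in> S" using Cons.prems X(1) by auto
  have "0 \<le> L" using lipschitz_on_nonneg[OF L[OF w]] .
  have Fz: "F i z \<in> X" and Gz: "G i z \<in> X" using X(2,3) i Cons.prems by blast+
  define D where "D = (A + L + B) / (1 - q) * r"
  let ?f = "nonlin (fold F w)" and ?g = "nonlin (fold G w)"
  have "nonlin (fold F (i # w)) z - nonlin (fold G (i # w)) z =
      ((nonlin (F i) z - nonlin (G i) z) + (deriv (F i) z - deriv (G i) z) * ?f (F i z)) +
      deriv (G i) z * ((?f (F i z) - ?f (G i z)) + (?f (G i z) - ?g (G i z)))"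
    unfolding nonlin_fold_Cons[OF Cons.prems(1) z] G.nonlin_fold_Cons[OF Cons.prems(1) z]
    by (simp add: algebra_simps)
  also have "cmod \<dots> \<le> (B * r + r * A) + q * (L * r + D)"
  proof (intro norm_triangle_mono norm_mult_mono B(2) i Cons.prems)
    have "dist (?f (F i z)) (?f (G i z)) \<le> L * dist (F i z) (G i z)"
      using lipschitz_onD[OF L[OF w] Fz Gz] .
    also have "\<dots> \<le> L * r"
      using r(2)[OF i Cons.prems(2)] \<open>0 \<le> L\<close> by (intro mult_left_mono) (auto simp: dist_norm)
    finally show "cmod (?f (F i z) - ?f (G i z)) \<le> L * r" by (simp add: dist_norm)
  qed (use A[OF w Fz] r(3) G'(2) Cons.IH[OF w Gz] i Cons.prems in \<open>auto simp: D_def\<close>)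
  also have "\<dots> \<le> D"
  proof -
    have "q * (L * r) \<le> 1 * (L * r)"
      using G'(1) r(1) \<open>0 \<le> L\<close> by (intro mult_right_mono) auto
    moreover have "(A + L + B) * r = (1 - q) * D" using G'(1) by (simp add: D_def)
    ultimately show ?thesis by (simp add: algebra_simps)
  qed
  finally show ?case by (simp only: D_def)
qed

end

section \<open>Analytic iterated function systems\<close>

lemma comp_word_eq_fold: "comp_word \<Phi> w = fold \<Phi> (rev w)"
  by (induction w) (simp_all add: comp_word_def)

definition analytic_ext :: "real \<Rightarrow> (real \<Rightarrow> real) \<Rightarrow> (complex \<Rightarrow> complex) \<Rightarrow> bool" where
  "analytic_ext \<epsilon> f F \<longleftrightarrow> complexification_on (B_nbhd (2 * \<epsilon>)) f F \<and> f ` {0..1} \<subseteq> {0..1} \<and>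
    F ` closure (B_nbhd \<epsilon>) \<subseteq> B_nbhd \<epsilon> \<and>
    (\<forall>z\<in>closure (B_nbhd \<epsilon>). 0 < cmod (deriv F z) \<and> cmod (deriv F z) < 1)"

lemma S_omega_iff_analytic_ext: "f \<in> S_omega \<epsilon> \<longleftrightarrow> (\<exists>F. analytic_ext \<epsilon> f F)"
  by (auto simp: S_omega_def analytic_ext_def complexification_on_def
    analytic_on_open[OF open_B_nbhd])

lemma analytic_extD:
  assumes "analytic_ext \<epsilon> f F"
  shows "complexification_on (B_nbhd (2 * \<epsilon>)) f F" "f ` {0..1} \<subseteq> {0..1}"
    "z \<in> closure (B_nbhd \<epsilon>) \<Longrightarrow> F z \<in> B_nbhd \<epsilon>"
    "z \<in> closure (B_nbhd \<epsilon>) \<Longrightarrow> 0 < cmod (deriv F z)"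
    "z \<in> closure (B_nbhd \<epsilon>) \<Longrightarrow> cmod (deriv F z) < 1"
  using assms by (auto simp: analytic_ext_def)

lemma analytic_ext_image_unit_seg:
  assumes "0 < \<epsilon>" and F: "analytic_ext \<epsilon> f F"
  shows "F ` unit_seg \<subseteq> unit_seg"
proof (rule image_subsetI)
  fix z assume "z \<in> unit_seg"
  then obtain x where x: "x \<in> {0..1}" "z = of_real x" by blast
  have "unit_seg \<subseteq> B_nbhd (2 * \<epsilon>)" using \<open>0 < \<epsilon>\<close> by (intro unit_seg_subset_B_nbhd) simp
  then have "F z = of_real (f x)"
    unfolding x(2) using x(1) by (intro complexification_onD(2)[OF analytic_extD(1)[OF F]]) blast
  then show "F z \<in> unit_seg" using analytic_extD(2)[OF F] x(1) by blast
qed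

lemma conformal_ifs_if_analytic_ext:
  assumes "0 < \<epsilon>" and ext: "\<And>i. i \<in> I \<Longrightarrow> analytic_ext \<epsilon> (\<Phi> i) (F i)"
  shows "conformal_ifs (B_nbhd \<epsilon>) I F"
proof
  fix i assume "i \<in> I"
  note F = analytic_extD[OF ext[OF this]]
  show "F i holomorphic_on B_nbhd \<epsilon>"
    using complexification_onD(1)[OF F(1)] B_nbhd_mono[of \<epsilon> "2 * \<epsilon>"] \<open>0 < \<epsilon>\<close>
    by (auto intro: holomorphic_on_subset)
  show "F i ` B_nbhd \<epsilon> \<subseteq> B_nbhd \<epsilon>" using F(3) closure_subset by blast
  show "deriv (F i) z \<noteq> 0" if "z \<in> B_nbhd \<epsilon>" for z
    using F(4)[of z] closure_subset that by auto
qed (rule open_B_nbhd)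

locale analytic_ifs =
  fixes \<epsilon> \<sigma> \<Lambda> :: real and N :: nat and \<Phi> :: "nat \<Rightarrow> real \<Rightarrow> real" and F :: "nat \<Rightarrow> complex \<Rightarrow> complex"
  assumes margin: "0 < \<sigma>" "\<sigma> < 1" "\<sigma> < \<epsilon>" and nonlin_bound_nonneg: "0 \<le> \<Lambda>"
    and ext: "k \<in> {1..N} \<Longrightarrow> analytic_ext \<epsilon> (\<Phi> k) (F k)"
    and maps_margin: "k \<in> {1..N} \<Longrightarrow> z \<in> closure (B_nbhd \<epsilon>) \<Longrightarrow> F k z \<in> B_nbhd (\<epsilon> - \<sigma>)"
    and deriv_ge: "k \<in> {1..N} \<Longrightarrow> z \<in> closure (B_nbhd \<epsilon>) \<Longrightarrow> \<sigma> \<le> cmod (deriv (F k) z)"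
    and deriv_le: "k \<in> {1..N} \<Longrightarrow> z \<in> closure (B_nbhd \<epsilon>) \<Longrightarrow> cmod (deriv (F k) z) \<le> 1 - \<sigma>"
    and nonlin_le: "k \<in> {1..N} \<Longrightarrow> z \<in> closure (B_nbhd \<epsilon>) \<Longrightarrow> cmod (nonlin (F k) z) \<le> \<Lambda>"

lemma eventually_less_continuous_on_compact:
  fixes m :: "'a::topological_space \<Rightarrow> real"
  assumes "compact K" "continuous_on K m" "\<And>z. z \<in> K \<Longrightarrow> 0 < m z"
  shows "\<forall>\<^sub>F s in at_right 0. \<forall>z\<in>K. s < m z"
proof (cases "K = {}")
  case False
  then obtain w where w: "w \<in> K" "\<And>z. z \<in> K \<Longrightarrow> m w \<le> m z"
    using continuous_attains_inf[OF assms(1) _ assms(2)] by blast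
  have "\<forall>\<^sub>F s in at_right 0. s < m w"
    using assms(3)[OF w(1)] by (auto simp: eventually_at_right)
  then show ?thesis by (rule eventually_mono) (use w(2) in force)
qed simp

lemma eventually_ge_continuous_on_compact:
  fixes m :: "'a::topological_space \<Rightarrow> real"
  assumes "compact K" "continuous_on K m"
  shows "\<forall>\<^sub>F s in at_top. \<forall>z\<in>K. m z \<le> s"
proof -
  have "bdd_above (m ` K)"
    by (intro bounded_imp_bdd_above compact_imp_bounded compact_continuous_image assms)
  then obtain B where "\<And>z. z \<in> K \<Longrightarrow> m z \<le> B" by (auto simp: bdd_above_def)
  then show ?thesis
    by (intro eventually_mono[OF eventually_ge_at_top[of B]]) (force intro: order_trans)
qed

lemma analytic_ext_continuous_higher_deriv:
  assumes "0 < \<epsilon>" "analytic_ext \<epsilon> f F"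
  shows "continuous_on (closure (B_nbhd \<epsilon>)) ((deriv ^^ j) F)"
proof -
  have "(deriv ^^ j) F holomorphic_on B_nbhd (2 * \<epsilon>)"
    by (intro holomorphic_higher_deriv open_B_nbhd
      complexification_onD(1)[OF analytic_extD(1)[OF assms(2)]])
  then show ?thesis
    using closure_B_nbhd_subset_B_nbhd[of \<epsilon> "2 * \<epsilon>"] \<open>0 < \<epsilon>\<close>
    by (auto intro: holomorphic_on_imp_continuous_on holomorphic_on_subset)
qed

lemma analytic_ext_eventually_margin:
  assumes "0 < \<epsilon>" and F: "analytic_ext \<epsilon> f F"
  shows "\<forall>\<^sub>F s in at_right 0. \<forall>z\<in>closure (B_nbhd \<epsilon>).
    s < cmod (deriv F z) \<and> cmod (deriv F z) < 1 - s \<and> F z \<in> B_nbhd (\<epsilon> - s)"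
proof -
  let ?K = "closure (B_nbhd \<epsilon>)"
  note cont = analytic_ext_continuous_higher_deriv[OF assms, of 0]
    analytic_ext_continuous_higher_deriv[OF assms, of 1]
  note ev = eventually_less_continuous_on_compact[OF compact_closure_B_nbhd]
  have "\<forall>\<^sub>F s in at_right 0. \<forall>z\<in>?K. s < cmod (deriv F z)"
    using cont analytic_extD(4)[OF F] by (intro ev continuous_intros) auto
  moreover have "\<forall>\<^sub>F s in at_right 0. \<forall>z\<in>?K. s < 1 - cmod (deriv F z)"
    using cont analytic_extD(5)[OF F] by (intro ev continuous_intros) auto
  moreover have "\<forall>\<^sub>F s in at_right 0. \<forall>z\<in>?K. s < \<epsilon> - infdist (F z) unit_seg"
    using cont analytic_extD(3)[OF F] by (intro ev continuous_intros) (auto simp: B_nbhd_eq_infdist)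
  ultimately show ?thesis
    by eventually_elim (auto simp: B_nbhd_eq_infdist less_diff_eq add.commute)
qed

lemma analytic_ext_eventually_nonlin_le:
  assumes "0 < \<epsilon>" and F: "analytic_ext \<epsilon> f F"
  shows "\<forall>\<^sub>F s in at_top. \<forall>z\<in>closure (B_nbhd \<epsilon>). cmod (nonlin F z) \<le> s"
proof (rule eventually_ge_continuous_on_compact[OF compact_closure_B_nbhd])
  show "continuous_on (closure (B_nbhd \<epsilon>)) (\<lambda>z. cmod (nonlin F z))"
    using analytic_ext_continuous_higher_deriv[OF assms, of 1]
      analytic_ext_continuous_higher_deriv[OF assms, of 2] analytic_extD(4)[OF F]
    unfolding nonlin_def by (intro continuous_intros) auto
qed

lemma analytic_ifs_exists:
  assumes "0 < \<epsilon>" and ext: "\<And>k. k \<in> {1..N} \<Longrightarrow> analytic_ext \<epsilon> (\<Phi> k) (F k)"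
  obtains \<sigma> \<Lambda> where "analytic_ifs \<epsilon> \<sigma> \<Lambda> N \<Phi> F"
proof -
  have "\<forall>\<^sub>F s in at_right 0. \<forall>k\<in>{1..N}. \<forall>z\<in>closure (B_nbhd \<epsilon>).
      s < cmod (deriv (F k) z) \<and> cmod (deriv (F k) z) < 1 - s \<and> F k z \<in> B_nbhd (\<epsilon> - s)"
    using analytic_ext_eventually_margin[OF \<open>0 < \<epsilon>\<close> ext]
    by (intro eventually_ball_finite[OF finite_atLeastAtMost]) blast
  moreover have "\<forall>\<^sub>F s in at_right 0. s \<in> {0<..<min 1 \<epsilon>}"
    using \<open>0 < \<epsilon>\<close> by (intro eventually_at_right_real) simp
  ultimately have "\<forall>\<^sub>F s in at_right 0. s \<in> {0<..<min 1 \<epsilon>} \<and> (\<forall>k\<in>{1..N}. \<forall>z\<in>closure (B_nbhd \<epsilon>).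
      s < cmod (deriv (F k) z) \<and> cmod (deriv (F k) z) < 1 - s \<and> F k z \<in> B_nbhd (\<epsilon> - s))"
    by eventually_elim auto
  then obtain \<sigma> where \<sigma>: "\<sigma> \<in> {0<..<min 1 \<epsilon>}" "\<forall>k\<in>{1..N}. \<forall>z\<in>closure (B_nbhd \<epsilon>).
      \<sigma> < cmod (deriv (F k) z) \<and> cmod (deriv (F k) z) < 1 - \<sigma> \<and> F k z \<in> B_nbhd (\<epsilon> - \<sigma>)"
    using eventually_happens'[OF trivial_limit_at_right_real] by blast
  have "\<forall>\<^sub>F s in at_top. \<forall>k\<in>{1..N}. \<forall>z\<in>closure (B_nbhd \<epsilon>). cmod (nonlin (F k) z) \<le> s"
    using analytic_ext_eventually_nonlin_le[OF \<open>0 < \<epsilon>\<close> ext]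
    by (intro eventually_ball_finite[OF finite_atLeastAtMost]) blast
  then have "\<forall>\<^sub>F s in at_top. 0 \<le> s \<and> (\<forall>k\<in>{1..N}. \<forall>z\<in>closure (B_nbhd \<epsilon>). cmod (nonlin (F k) z) \<le> s)"
    using eventually_ge_at_top by eventually_elim auto
  then obtain \<Lambda> where "0 \<le> \<Lambda>" "\<forall>k\<in>{1..N}. \<forall>z\<in>closure (B_nbhd \<epsilon>). cmod (nonlin (F k) z) \<le> \<Lambda>"
    using eventually_happens'[OF trivial_limit_at_top_linorder] by blast
  with \<sigma> ext have "analytic_ifs \<epsilon> \<sigma> \<Lambda> N \<Phi> F"
    by unfold_locales (auto simp: less_imp_le)
  then show ?thesis by (rule that)
qed

context analytic_ifs
begin

lemma eps_pos: "0 < \<epsilon>"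
  using margin by simp

lemma B_nbhd_subset_closure: "B_nbhd \<epsilon> \<subseteq> closure (B_nbhd \<epsilon>)"
  by (rule closure_subset)

lemma unit_seg_subset:
  "unit_seg \<subseteq> B_nbhd \<epsilon>" "unit_seg \<subseteq> closure (B_nbhd \<epsilon>)" "unit_seg \<subseteq> B_nbhd (2 * \<epsilon>)"
  using unit_seg_subset_B_nbhd[of \<epsilon>] unit_seg_subset_B_nbhd[of "2 * \<epsilon>"] eps_pos
    B_nbhd_subset_closure
  by auto

lemma complexification: "k \<in> {1..N} \<Longrightarrow> complexification_on (B_nbhd \<epsilon>) (\<Phi> k) (F k)"
  using eps_pos by (intro complexification_on_subset[OF analytic_extD(1)[OF ext]] B_nbhd_mono) auto

end

sublocale analytic_ifs \<subseteq> conformal_ifs "B_nbhd \<epsilon>" "{1..N}" F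
  using eps_pos ext by (rule conformal_ifs_if_analytic_ext)

context analytic_ifs
begin

lemma complexification_fold:
  "set w \<subseteq> {1..N} \<Longrightarrow> complexification_on (B_nbhd \<epsilon>) (fold \<Phi> w) (fold F w)"
  using complexification_on_fold[where I = "{1..N}", OF complexification maps_domain] .

lemma fold_in_unit_interval: "set w \<subseteq> {1..N} \<Longrightarrow> x \<in> {0..1} \<Longrightarrow> fold \<Phi> w x \<in> {0..1}"
  using analytic_extD(2)[OF ext] by (rule fold_mem)

lemma fold_of_real:
  "set w \<subseteq> {1..N} \<Longrightarrow> x \<in> {0..1} \<Longrightarrow> fold F w (of_real x) = of_real (fold \<Phi> w x)"
  using complexification_onD(2)[OF complexification_fold] unit_seg_subset(1) by blast

lemma fold_bounded_holomorphic: "set w \<subseteq> {1..N} \<Longrightarrow> fold F w \<in> bounded_holomorphic (B_nbhd \<epsilon>) (1 + \<epsilon>)"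
  using holomorphic_fold fold_in_domain norm_less_if_in_B_nbhd
  by (intro bounded_holomorphicI) (auto intro: less_imp_le)

lemma nonlin_fold_bounded_holomorphic:
  assumes "set w \<subseteq> {1..N}"
  shows "nonlin (fold F w) \<in> bounded_holomorphic (B_nbhd \<epsilon>) (\<Lambda> / \<sigma>)"
proof
  show "nonlin (fold F w) holomorphic_on B_nbhd \<epsilon>"
    using assms by (rule holomorphic_nonlin_fold)
  show "cmod (nonlin (fold F w) z) \<le> \<Lambda> / \<sigma>" if "z \<in> B_nbhd \<epsilon>" for z
    using norm_nonlin_fold_le[of "B_nbhd \<epsilon>" "1 - \<sigma>" \<Lambda> w z] that assms margin nonlin_bound_nonneg
      maps_domain deriv_le nonlin_le B_nbhd_subset_closure by (simp add: subset_iff)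
qed

lemma fold_image_unit_interval:
  assumes w: "set w \<subseteq> {1..N}"
  obtains a b where "0 \<le> a" "b \<le> 1" "\<sigma> ^ length w \<le> b - a" "fold \<Phi> w ` {0..1} = {a..b}"
proof -
  let ?f = "fold \<Phi> w"
  have deriv: "\<sigma> ^ length w \<le> cmod (deriv (fold F w) (of_real x))" if "x \<in> {0..1}" for x
    using that w margin deriv_ge B_nbhd_subset_closure unit_seg_subset(1)
    by (intro deriv_fold_lower_bound) auto
  have "\<sigma> ^ length w * \<bar>0 - 1\<bar> \<le> \<bar>?f 0 - ?f 1\<bar>"
    by (rule complexification_on_expansion[OF open_domain complexification_fold[OF w]
          unit_seg_subset(1) deriv]) auto
  moreover have "?f ` {0..1} = closed_segment (?f 0) (?f 1)"
    using margin by (intro complexification_on_image_interval[OF open_domain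
          complexification_fold[OF w] unit_seg_subset(1) _ deriv]) auto
  moreover have "?f 0 \<in> {0..1}" "?f 1 \<in> {0..1}"
    using fold_in_unit_interval[OF w] by auto
  ultimately show ?thesis
    by (intro that[of "min (?f 0) (?f 1)" "max (?f 0) (?f 1)"])
      (auto simp: closed_segment_eq_real_ivl min_def max_def)
qed

end

section \<open>From a nonlinearity gap to separation\<close>

definition nonlin_gap :: "'i set \<Rightarrow> ('i \<Rightarrow> complex \<Rightarrow> complex) \<Rightarrow> real \<Rightarrow> bool" where
  "nonlin_gap I F \<delta> \<longleftrightarrow> (\<forall>k l v w. k \<noteq> l \<longrightarrow> set (k # v) \<subseteq> I \<longrightarrow> set (l # w) \<subseteq> I \<longrightarrow>
    (\<exists>z\<in>unit_seg. \<delta> \<le> cmod (nonlin (fold F (k # v)) z - nonlin (fold F (l # w)) z)))"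

lemma nonlin_gapI:
  assumes "\<And>k l v w. k \<noteq> l \<Longrightarrow> set (k # v) \<subseteq> I \<Longrightarrow> set (l # w) \<subseteq> I \<Longrightarrow>
    \<exists>z\<in>unit_seg. \<delta> \<le> cmod (nonlin (fold F (k # v)) z - nonlin (fold F (l # w)) z)"
  shows "nonlin_gap I F \<delta>"
  using assms unfolding nonlin_gap_def by blast

lemma nonlin_gapD:
  assumes "nonlin_gap I F \<delta>" "k \<noteq> l" "set (k # v) \<subseteq> I" "set (l # w) \<subseteq> I"
  shows "\<exists>z\<in>unit_seg. \<delta> \<le> cmod (nonlin (fold F (k # v)) z - nonlin (fold F (l # w)) z)"
  using assms unfolding nonlin_gap_def by blast

lemma exponential_lower_bound:
  fixes A q :: real
  assumes "0 < A" "0 < q"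
  obtains C where "0 < C" "\<And>n. 0 < n \<Longrightarrow> C ^ n \<le> A * q ^ n"
proof (rule that)
  show "0 < min A 1 * q" using assms by simp
  fix n :: nat assume "0 < n"
  then have "min A 1 ^ n \<le> min A 1 ^ 1"
    using assms by (intro power_decreasing) auto
  then show "(min A 1 * q) ^ n \<le> A * q ^ n"
    using assms by (simp add: power_mult_distrib)
qed

context analytic_ifs
begin

lemma deriv_fold_diff_lower_bound:
  assumes v: "set v \<subseteq> {1..N}" and w: "set w \<subseteq> {1..N}" and z: "z \<in> B_nbhd \<epsilon>"
    and l: "l \<le> \<sigma> ^ length v" and \<kappa>: "0 \<le> \<kappa>" "\<kappa> \<le> cmod (nonlin (fold F v) z - nonlin (fold F w) z)"
  obtains j where "j \<le> 2"
    "l * \<kappa> / (1 + \<Lambda> / \<sigma>) \<le> cmod ((deriv ^^ j) (\<lambda>z. fold F v z - fold F w z) z)"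
proof -
  let ?h = "\<lambda>z. fold F v z - fold F w z"
  define m where "m = max (cmod ((deriv ^^ 1) ?h z)) (cmod ((deriv ^^ 2) ?h z))"
  have "l \<le> cmod (deriv (fold F v) z)"
    using margin deriv_ge B_nbhd_subset_closure
    by (intro order_trans[OF l] deriv_fold_lower_bound v z) auto
  then have "l * \<kappa> \<le> cmod (deriv (fold F v) z) * cmod (nonlin (fold F v) z - nonlin (fold F w) z)"
    using \<kappa> by (intro mult_mono) auto
  also have "\<dots> \<le> cmod ((deriv ^^ 2) ?h z) + cmod (nonlin (fold F w) z) * cmod (deriv ?h z)"
    by (intro norm_nonlin_diff_times_deriv_le[OF open_domain] holomorphic_fold
      deriv_fold_nonzero v w z)
  also have "\<dots> \<le> m + \<Lambda> / \<sigma> * m"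
    using bounded_holomorphicD(2)[OF nonlin_fold_bounded_holomorphic[OF w] z]
    by (intro add_mono mult_mono) (auto simp: m_def intro: order_trans[OF norm_ge_zero])
  also have "\<dots> = (1 + \<Lambda> / \<sigma>) * m" by (simp add: algebra_simps)
  finally have "l * \<kappa> / (1 + \<Lambda> / \<sigma>) \<le> m"
    using margin nonlin_bound_nonneg by (simp add: pos_divide_le_eq add_pos_nonneg mult.commute)
  then show ?thesis
    using that[of 1] that[of 2] by (auto simp: m_def max_def split: if_splits)
qed

lemma fold_diff_lower_bound:
  fixes a b l x :: real
  assumes v: "set v \<subseteq> {1..N}" and w: "set w \<subseteq> {1..N}"
    and M: "\<And>i z. i \<le> Suc 2 \<Longrightarrow> z \<in> unit_seg \<Longrightarrow>
      cmod ((deriv ^^ i) (\<lambda>z. fold F v z - fold F w z) z) \<le> M"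
    and ab: "0 \<le> a" "b \<le> 1" and l: "0 < l" "l \<le> b - a" "l \<le> \<sigma> ^ length v"
    and \<kappa>: "0 < \<kappa>" "\<kappa> \<le> 1" and x: "x \<in> {a..b}"
      "\<kappa> \<le> cmod (nonlin (fold F v) (of_real x) - nonlin (fold F w) (of_real x))"
  shows "\<exists>y\<in>{a..b}. (l * \<kappa> / (1 + \<Lambda> / \<sigma>) * (l / (4 + M))) ^ 4 ^ 2 \<le> \<bar>fold \<Phi> v y - fold \<Phi> w y\<bar>"
proof -
  let ?h = "\<lambda>z. fold F v z - fold F w z"
  have "1 \<le> 1 + \<Lambda> / \<sigma>" using margin nonlin_bound_nonneg by simp
  moreover have "l * \<kappa> \<le> 1" using ab l \<kappa> by (intro mult_le_one) auto
  ultimately have \<kappa>': "0 < l * \<kappa> / (1 + \<Lambda> / \<sigma>)" "l * \<kappa> / (1 + \<Lambda> / \<sigma>) \<le> 1"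
    using l \<kappa> by (simp_all add: divide_le_eq)
  have "complex_of_real x \<in> B_nbhd \<epsilon>" using x(1) ab unit_seg_subset(1) by auto
  then obtain j where j: "j \<le> 2" "l * \<kappa> / (1 + \<Lambda> / \<sigma>) \<le> cmod ((deriv ^^ j) ?h (of_real x))"
    using deriv_fold_diff_lower_bound[OF v w _ l(3) _ x(2)] \<kappa> by auto
  have "?h holomorphic_on B_nbhd \<epsilon>"
    by (intro holomorphic_on_diff holomorphic_fold v w)
  from holomorphic_Landau_lower_bound[OF open_domain unit_seg_subset(1) this M j(1) ab l(1,2) \<kappa>'
      x(1) j(2)]
  obtain y where y: "y \<in> {a..b}"
    "(l * \<kappa> / (1 + \<Lambda> / \<sigma>) * (l / (4 + M))) ^ 4 ^ 2 \<le> cmod (?h (of_real y))"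
    by blast
  have "y \<in> {0..1}" using y(1) ab by auto
  then have "cmod (?h (of_real y)) = \<bar>fold \<Phi> v y - fold \<Phi> w y\<bar>"
    unfolding fold_of_real[OF v \<open>y \<in> {0..1}\<close>] fold_of_real[OF w \<open>y \<in> {0..1}\<close>]
    by (simp flip: of_real_diff)
  with y show ?thesis by auto
qed

lemma separation_if_innermost_letters_differ:
  assumes gap: "nonlin_gap {1..N} F \<delta>" and "0 < \<delta>"
  obtains A D where "0 < A"
    "\<And>k v l w r (a::real) b. k \<noteq> l \<Longrightarrow> set (k # v) \<subseteq> {1..N} \<Longrightarrow> set (l # w) \<subseteq> {1..N} \<Longrightarrow>
      0 \<le> a \<Longrightarrow> b \<le> 1 \<Longrightarrow> 0 < r \<Longrightarrow> r \<le> b - a \<Longrightarrow> r \<le> \<sigma> ^ length (k # v) \<Longrightarrow>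
      \<exists>y\<in>{a..b}. A * r ^ D \<le> \<bar>fold \<Phi> (k # v) y - fold \<Phi> (l # w) y\<bar>"
proof -
  obtain c E where c: "0 < c" "c \<le> 1"
    and large: "\<And>g. g \<in> bounded_holomorphic (B_nbhd \<epsilon>) (\<Lambda> / \<sigma> + \<Lambda> / \<sigma>) \<Longrightarrow>
      \<exists>z\<in>unit_seg. \<delta> \<le> cmod (g z) \<Longrightarrow> large_on_subintervals c E g"
    by (rule large_on_subintervals_by_normality[OF open_domain connected_B_nbhd unit_seg_subset(1)
          compact_unit_seg unit_seg_subset(1) \<open>0 < \<delta>\<close>]) blast
  obtain M where "0 \<le> M" and M: "\<And>g i z. g \<in> bounded_holomorphic (B_nbhd \<epsilon>) (1 + \<epsilon> + (1 + \<epsilon>)) \<Longrightarrow>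
      i \<le> Suc 2 \<Longrightarrow> z \<in> unit_seg \<Longrightarrow> cmod ((deriv ^^ i) g z) \<le> M"
    by (rule higher_derivs_uniformly_bounded[OF open_domain compact_unit_seg unit_seg_subset(1)])
      blast
  define A where "A = (c ^ E / ((1 + \<Lambda> / \<sigma>) * (4 + M))) ^ 4 ^ 2"
  show ?thesis
  proof (rule that)
    have "0 < 1 + \<Lambda> / \<sigma>" using margin nonlin_bound_nonneg by (simp add: add_pos_nonneg)
    then show "0 < A" using c \<open>0 \<le> M\<close> by (simp add: A_def)
    fix k v l w and a b r :: real
    assume kl: "k \<noteq> l" and kv: "set (k # v) \<subseteq> {1..N}" and lw: "set (l # w) \<subseteq> {1..N}"
      and ab: "0 \<le> a" "b \<le> 1" and r: "0 < r" "r \<le> b - a" "r \<le> \<sigma> ^ length (k # v)"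
    have "large_on_subintervals c E (\<lambda>z. nonlin (fold F (k # v)) z - nonlin (fold F (l # w)) z)"
      by (intro large bounded_holomorphic_diff nonlin_fold_bounded_holomorphic kv lw
          nonlin_gapD[OF gap kl])
    then obtain x where x: "x \<in> {a..b}"
      "(c * r) ^ E \<le> cmod (nonlin (fold F (k # v)) (of_real x) - nonlin (fold F (l # w)) (of_real x))"
      using ab r(1,2) by (rule large_on_subintervalsD)
    have "c * r \<le> 1" using c r ab by (intro mult_le_one) auto
    then have "0 < (c * r) ^ E" "(c * r) ^ E \<le> 1"
      using c r by (auto intro: power_le_one)
    then have ex: "\<exists>y\<in>{a..b}. (r * (c * r) ^ E / (1 + \<Lambda> / \<sigma>) * (r / (4 + M))) ^ 4 ^ 2
        \<le> \<bar>fold \<Phi> (k # v) y - fold \<Phi> (l # w) y\<bar>"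
      by (intro fold_diff_lower_bound[where x = x] kv lw ab r x M bounded_holomorphic_diff
        fold_bounded_holomorphic)
    have eq: "r * (c * r) ^ E / (1 + \<Lambda> / \<sigma>) * (r / (4 + M))
        = c ^ E / ((1 + \<Lambda> / \<sigma>) * (4 + M)) * r ^ (2 + E)"
      by (simp add: power_mult_distrib power_add power2_eq_square)
    show "\<exists>y\<in>{a..b}. A * r ^ ((2 + E) * 4 ^ 2) \<le> \<bar>fold \<Phi> (k # v) y - fold \<Phi> (l # w) y\<bar>"
      using ex unfolding A_def power_mult power_mult_distrib[symmetric] eq .
  qed
qed

lemma abs_comp_word_diff_le_SUP:
  assumes u: "set u \<subseteq> {1..N}" and v: "set v \<subseteq> {1..N}" and x: "x \<in> {0..1}"
  shows "\<bar>comp_word \<Phi> u x - comp_word \<Phi> v x\<bar> \<le> (SUP x\<in>{0..1}. \<bar>comp_word \<Phi> u x - comp_word \<Phi> v x\<bar>)"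
proof (intro cSUP_upper x bdd_aboveI2)
  show "\<bar>comp_word \<Phi> u x - comp_word \<Phi> v x\<bar> \<le> 1" if "x \<in> {0..1}" for x
    using fold_in_unit_interval[OF _ that, of "rev u"]
      fold_in_unit_interval[OF _ that, of "rev v"] u v
    by (auto simp: comp_word_eq_fold)
qed

theorem SESC_if_nonlin_gap:
  assumes "nonlin_gap {1..N} F \<delta>" "0 < \<delta>"
  shows "SESC N \<Phi>"
proof -
  obtain A D where "0 < A" and A: "\<And>k v l w r (a::real) b. k \<noteq> l \<Longrightarrow> set (k # v) \<subseteq> {1..N} \<Longrightarrow>
      set (l # w) \<subseteq> {1..N} \<Longrightarrow> 0 \<le> a \<Longrightarrow> b \<le> 1 \<Longrightarrow> 0 < r \<Longrightarrow> r \<le> b - a \<Longrightarrow> r \<le> \<sigma> ^ length (k # v) \<Longrightarrow>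
      \<exists>y\<in>{a..b}. A * r ^ D \<le> \<bar>fold \<Phi> (k # v) y - fold \<Phi> (l # w) y\<bar>"
    by (rule separation_if_innermost_letters_differ[OF assms]) blast
  obtain C where "0 < C" and C: "\<And>n. 0 < n \<Longrightarrow> C ^ n \<le> A * (\<sigma> ^ D) ^ n"
    using exponential_lower_bound[OF \<open>0 < A\<close> zero_less_power[OF margin(1)]] by blast
  have "C ^ n \<le> (SUP x\<in>{0..1}. \<bar>comp_word \<Phi> u x - comp_word \<Phi> u' x\<bar>)"
    if u: "u \<in> words N n" and u': "u' \<in> words N n" and "u \<noteq> u'" for n u u'
  proof -
    have sets: "set u \<subseteq> {1..N}" "set u' \<subseteq> {1..N}" and len: "length (rev u) = n"
      using u u' by (auto simp: words_def)
    have "rev u \<noteq> rev u'" "length (rev u) = length (rev u')"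
      using that by (auto simp: words_def)
    from same_length_different[OF this] obtain p k v l w where "k \<noteq> l"
      and eq: "rev u = p @ k # v" "rev u' = p @ l # w" by auto
    have "set (rev u) \<subseteq> {1..N}" "set (rev u') \<subseteq> {1..N}" using sets by simp_all
    then have p: "set p \<subseteq> {1..N}" and kv: "set (k # v) \<subseteq> {1..N}" and lw: "set (l # w) \<subseteq> {1..N}"
      unfolding eq by auto
    obtain a b where ab: "0 \<le> a" "b \<le> 1" "\<sigma> ^ length p \<le> b - a"
      and image: "fold \<Phi> p ` {0..1} = {a..b}"
      using fold_image_unit_interval[OF p] .
    have "\<sigma> ^ n \<le> \<sigma> ^ length p" and kv_length: "\<sigma> ^ n \<le> \<sigma> ^ length (k # v)"
      using len margin unfolding eq by (auto intro!: power_decreasing)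
    then have "\<sigma> ^ n \<le> b - a" using ab(3) by linarith
    then obtain y where "y \<in> {a..b}" "A * (\<sigma> ^ n) ^ D \<le> \<bar>fold \<Phi> (k # v) y - fold \<Phi> (l # w) y\<bar>"
      using A[OF \<open>k \<noteq> l\<close> kv lw ab(1,2) zero_less_power[OF margin(1)] _ kv_length] by blast
    then obtain x where x: "x \<in> {0..1}" "A * (\<sigma> ^ n) ^ D \<le> \<bar>comp_word \<Phi> u x - comp_word \<Phi> u' x\<bar>"
      unfolding image[symmetric] comp_word_eq_fold eq by auto
    have "C ^ n \<le> A * (\<sigma> ^ n) ^ D"
      using C[of n] len unfolding eq by (simp add: mult.commute flip: power_mult)
    also note x(2)
    also note abs_comp_word_diff_le_SUP[OF sets x(1)]
    finally show ?thesis .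
  qed
  with \<open>0 < C\<close> show ?thesis unfolding SESC_def by blast
qed

end

section \<open>Stability of a nonlinearity gap\<close>

lemma d2_eq_sum: "d2 f g = (\<Sum>j\<le>2. SUP x\<in>{0..1}. \<bar>(deriv ^^ j) f x - (deriv ^^ j) g x\<bar>)"
  by (simp add: d2_def numeral_2_eq_2)

context
  fixes S f F g G
  assumes S: "open S" "unit_seg \<subseteq> S"
    and f: "complexification_on S f F" and g: "complexification_on S g G"
begin

lemma norm_higher_deriv_diff_of_real:
  assumes "x \<in> {0..1}"
  shows "cmod ((deriv ^^ j) F (of_real x) - (deriv ^^ j) G (of_real x))
    = \<bar>(deriv ^^ j) f x - (deriv ^^ j) g x\<bar>"
proof -
  have x: "complex_of_real x \<in> S" using S(2) assms by blast
  show ?thesis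
    unfolding complexification_onD(2)[OF complexification_on_higher_deriv[OF S(1) f] x]
      complexification_onD(2)[OF complexification_on_higher_deriv[OF S(1) g] x]
    by (simp flip: of_real_diff)
qed

lemma norm_higher_deriv_diff_le_d2:
  assumes "j \<le> 2" "z \<in> unit_seg"
  shows "cmod ((deriv ^^ j) F z - (deriv ^^ j) G z) \<le> d2 f g"
proof -
  let ?D = "\<lambda>j x. \<bar>(deriv ^^ j) f x - (deriv ^^ j) g x\<bar>"
  have le_SUP: "?D j x \<le> (SUP x\<in>{0..1}. ?D j x)" if "x \<in> {0..1}" for j x
  proof (rule cSUP_upper[OF that])
    have "continuous_on {0..1} ((deriv ^^ j) f)" "continuous_on {0..1} ((deriv ^^ j) g)"
      using complexification_on_continuous complexification_on_higher_deriv S f g by blast+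
    then have "continuous_on {0..1} (?D j)" by (intro continuous_intros)
    then show "bdd_above (?D j ` {0..1})"
      by (intro bounded_imp_bdd_above compact_imp_bounded compact_continuous_image) auto
  qed
  obtain x where x: "x \<in> {0..1}" "z = of_real x" using assms(2) by blast
  have "cmod ((deriv ^^ j) F z - (deriv ^^ j) G z) \<le> (SUP x\<in>{0..1}. ?D j x)"
    using le_SUP[OF x(1)] by (simp only: x(2) norm_higher_deriv_diff_of_real[OF x(1)])
  also have "\<dots> \<le> d2 f g"
    unfolding d2_eq_sum using \<open>j \<le> 2\<close> le_SUP[of 0]
    by (intro member_le_sum) (auto intro: order_trans[OF abs_ge_zero])
  finally show ?thesis .
qed

lemma d2_le:
  assumes "\<And>j z. j \<le> 2 \<Longrightarrow> z \<in> unit_seg \<Longrightarrow> cmod ((deriv ^^ j) F z - (deriv ^^ j) G z) \<le> r"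
  shows "d2 f g \<le> 3 * r"
proof -
  have "(SUP x\<in>{0..1}. \<bar>(deriv ^^ j) f x - (deriv ^^ j) g x\<bar>) \<le> r" if "j \<le> 2" for j
    using assms[OF that] by (intro cSUP_least) (auto simp flip: norm_higher_deriv_diff_of_real)
  then have "d2 f g \<le> (\<Sum>j\<le>2::nat. r)"
    unfolding d2_eq_sum by (intro sum_mono) simp
  then show ?thesis by simp
qed

end

context analytic_ifs
begin

lemma norm_deriv_bounds_if_close:
  assumes "k \<in> {1..N}" "z \<in> closure (B_nbhd \<epsilon>)" and "cmod (deriv (F k) z - d) \<le> \<sigma> / 2"
  shows "\<sigma> / 2 \<le> cmod d" "cmod d \<le> 1 - \<sigma> / 2"
  using deriv_ge[OF assms(1,2)] deriv_le[OF assms(1,2)] assms(3)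
    norm_triangle_ineq2[of "deriv (F k) z" d] norm_triangle_ineq2[of d "deriv (F k) z"]
    norm_minus_commute[of d "deriv (F k) z"]
  by linarith+

lemma norm_nonlin_diff_le_if_close:
  assumes k: "k \<in> {1..N}" and z: "z \<in> closure (B_nbhd \<epsilon>)" and "r \<le> \<sigma> / 2"
    and close: "cmod (deriv (F k) z - deriv g z) \<le> r"
      "cmod ((deriv ^^ 2) (F k) z - (deriv ^^ 2) g z) \<le> r"
  shows "cmod (nonlin (F k) z - nonlin g z) \<le> 2 * (1 + \<Lambda>) / \<sigma> * r"
proof -
  have g': "\<sigma> / 2 \<le> cmod (deriv g z)"
    using norm_deriv_bounds_if_close(1)[OF k z, of "deriv g z"] close(1) \<open>r \<le> \<sigma> / 2\<close> by linarith
  have nz: "deriv (F k) z \<noteq> 0" "deriv g z \<noteq> 0"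
    using deriv_ge[OF k z] g' margin by auto
  have "nonlin (F k) z - nonlin g z =
      ((deriv ^^ 2) (F k) z - (deriv ^^ 2) g z - nonlin (F k) z * (deriv (F k) z - deriv g z))
      / deriv g z"
    using nz by (simp add: nonlin_def field_simps)
  also have "cmod \<dots> \<le> (r + \<Lambda> * r) / (\<sigma> / 2)"
    unfolding norm_divide
  proof (rule frac_le)
    show "cmod ((deriv ^^ 2) (F k) z - (deriv ^^ 2) g z
        - nonlin (F k) z * (deriv (F k) z - deriv g z)) \<le> r + \<Lambda> * r"
      by (intro norm_triangle_le_diff add_mono norm_mult_mono[OF nonlin_le[OF k z]] close)
    show "0 \<le> r + \<Lambda> * r"
      using order_trans[OF norm_ge_zero close(1)] nonlin_bound_nonneg by simp
  qed (use g' margin in auto)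
  also have "\<dots> = 2 * (1 + \<Lambda>) / \<sigma> * r" by (simp add: algebra_simps)
  finally show ?thesis .
qed

definition nonlin_modulus :: real where
  "nonlin_modulus = (\<Lambda> / \<sigma> + 2 * (\<Lambda> / \<sigma>) / \<epsilon> + 2 * (1 + \<Lambda>) / \<sigma>) / (1 - (1 - \<sigma> / 2))"

lemma nonlin_modulus_pos: "0 < nonlin_modulus"
  using margin nonlin_bound_nonneg eps_pos by (simp add: nonlin_modulus_def add_nonneg_pos)

lemma norm_nonlin_fold_diff_le_if_d2_le:
  assumes extG: "\<And>k. k \<in> {1..N} \<Longrightarrow> analytic_ext \<epsilon> (\<Psi> k) (G k)"
    and d2: "\<And>k. k \<in> {1..N} \<Longrightarrow> d2 (\<Phi> k) (\<Psi> k) \<le> r" and r: "0 \<le> r" "r \<le> \<sigma> / 2"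
    and "set w \<subseteq> {1..N}" "z \<in> unit_seg"
  shows "cmod (nonlin (fold F w) z - nonlin (fold G w) z) \<le> nonlin_modulus * r"
proof -
  have close: "cmod ((deriv ^^ j) (F k) z - (deriv ^^ j) (G k) z) \<le> r"
    if "k \<in> {1..N}" "j \<le> 2" "z \<in> unit_seg" for j k z
    using norm_higher_deriv_diff_le_d2[OF open_B_nbhd unit_seg_subset(3)
        analytic_extD(1)[OF ext[OF that(1)]] analytic_extD(1)[OF extG[OF that(1)]] that(2,3)] d2[OF that(1)]
    by (rule order_trans)
  show ?thesis
    unfolding nonlin_modulus_def
  proof (rule norm_nonlin_fold_diff_le[where X = unit_seg])
    show "conformal_ifs (B_nbhd \<epsilon>) {1..N} G"
      using eps_pos extG by (rule conformal_ifs_if_analytic_ext)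
    show "F k ` unit_seg \<subseteq> unit_seg" "G k ` unit_seg \<subseteq> unit_seg" if "k \<in> {1..N}" for k
      using analytic_ext_image_unit_seg[OF eps_pos] ext[OF that] extG[OF that] by blast+
    fix w assume w: "set w \<subseteq> {1..N}"
    show "cmod (nonlin (fold F w) z) \<le> \<Lambda> / \<sigma>" if "z \<in> unit_seg" for z
      using bounded_holomorphicD(2)[OF nonlin_fold_bounded_holomorphic[OF w]] that
        unit_seg_subset(1) by blast
    show "(2 * (\<Lambda> / \<sigma>) / \<epsilon>)-lipschitz_on unit_seg (nonlin (fold F w))"
      using eps_pos nonlin_fold_bounded_holomorphic[OF w] by (rule lipschitz_on_unit_seg)
  next
    fix k z assume k: "k \<in> {1..N}" and z: "z \<in> unit_seg"
    note close = close[OF k _ z, of 0] close[OF k _ z, of 1] close[OF k _ z, of 2]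
    show "cmod (F k z - G k z) \<le> r" "cmod (deriv (F k) z - deriv (G k) z) \<le> r"
      using close by simp_all
    then show "cmod (deriv (G k) z) \<le> 1 - \<sigma> / 2"
      using norm_deriv_bounds_if_close(2)[OF k, of z] z unit_seg_subset(2) r(2) by force
    show "cmod (nonlin (F k) z - nonlin (G k) z) \<le> 2 * (1 + \<Lambda>) / \<sigma> * r"
      using close z unit_seg_subset(2) r(2) by (intro norm_nonlin_diff_le_if_close k) auto
  qed (use margin nonlin_bound_nonneg unit_seg_subset(1) r \<open>set w \<subseteq> {1..N}\<close> \<open>z \<in> unit_seg\<close> in auto)
qed

theorem nonlin_gap_stable:
  assumes gap: "nonlin_gap {1..N} F \<delta>" and "0 < \<delta>"
  obtains r where "0 < r" "\<And>\<Psi> G. (\<And>k. k \<in> {1..N} \<Longrightarrow> analytic_ext \<epsilon> (\<Psi> k) (G k)) \<Longrightarrow>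
    (\<And>k. k \<in> {1..N} \<Longrightarrow> d2 (\<Phi> k) (\<Psi> k) \<le> r) \<Longrightarrow> nonlin_gap {1..N} G (\<delta> / 2)"
proof -
  define r where "r = min (\<sigma> / 2) (\<delta> / (4 * nonlin_modulus))"
  have r: "0 < r" "r \<le> \<sigma> / 2" using margin nonlin_modulus_pos \<open>0 < \<delta>\<close> by (auto simp: r_def)
  have "r \<le> \<delta> / (4 * nonlin_modulus)" by (simp add: r_def)
  then have modulus_r: "nonlin_modulus * r \<le> \<delta> / 4"
    using nonlin_modulus_pos by (simp add: field_simps)
  show ?thesis
  proof (rule that[OF r(1)])
    fix \<Psi> G
    assume \<Psi>: "\<And>k. k \<in> {1..N} \<Longrightarrow> analytic_ext \<epsilon> (\<Psi> k) (G k)" "\<And>k. k \<in> {1..N} \<Longrightarrow> d2 (\<Phi> k) (\<Psi> k) \<le> r"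
    have close: "cmod (nonlin (fold F w) z - nonlin (fold G w) z) \<le> \<delta> / 4"
      if "set w \<subseteq> {1..N}" "z \<in> unit_seg" for w z
      using norm_nonlin_fold_diff_le_if_d2_le[OF \<Psi> less_imp_le[OF r(1)] r(2) that] modulus_r
      by linarith
    have triangle: "cmod (a - b) \<le> cmod (a' - b') + cmod (a - a') + cmod (b - b')"
      for a b a' b' :: complex
      by norm
    show "nonlin_gap {1..N} G (\<delta> / 2)"
    proof (rule nonlin_gapI)
      fix k l v w assume kl: "k \<noteq> l" and kv: "set (k # v) \<subseteq> {1..N}" and lw: "set (l # w) \<subseteq> {1..N}"
      obtain z where z: "z \<in> unit_seg"
        "\<delta> \<le> cmod (nonlin (fold F (k # v)) z - nonlin (fold F (l # w)) z)"
        using nonlin_gapD[OF gap kl kv lw] ..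
      show "\<exists>z\<in>unit_seg. \<delta> / 2 \<le> cmod (nonlin (fold G (k # v)) z - nonlin (fold G (l # w)) z)"
        using z(2) close[OF kv z(1)] close[OF lw z(1)]
          triangle[of "nonlin (fold F (k # v)) z" "nonlin (fold F (l # w)) z"
            "nonlin (fold G (k # v)) z" "nonlin (fold G (l # w)) z"]
        by (intro bexI[OF _ z(1)]) linarith
    qed
  qed
qed

end

section \<open>Creating a nonlinearity gap\<close>

text \<open>The linear term makes the bump vanish at the end points of the unit interval, so that adding a
  small multiple of it to a monotone map does not change the image of the interval.\<close>

definition bump_coeff :: "nat \<Rightarrow> real \<Rightarrow> real" where
  "bump_coeff n R = 2 / (real (n + 2) * real (n + 1) * R ^ n)"

definition bump :: "nat \<Rightarrow> real \<Rightarrow> 'a::real_normed_field \<Rightarrow> 'a" where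
  "bump n R z = of_real (bump_coeff n R) * (z ^ (n + 2) - z)"

lemma bump_coeff_nonneg: "0 \<le> R \<Longrightarrow> 0 \<le> bump_coeff n R"
  by (simp add: bump_coeff_def)

lemma bump_coeff_mult_power: "R \<noteq> 0 \<Longrightarrow> bump_coeff n R * R ^ n = 2 / (real (n + 2) * real (n + 1))"
  by (simp add: bump_coeff_def del: of_nat_add)

lemma complexification_on_bump: "complexification_on S (bump n R) (bump n R)"
  by (auto simp: complexification_on_def bump_def[abs_def] intro!: holomorphic_intros)

lemma has_field_derivative_power_Suc:
  "((\<lambda>z. z ^ Suc n) has_field_derivative of_nat (Suc n) * z ^ n) (at (z :: 'a::real_normed_field))"
  by (rule DERIV_cong[OF DERIV_power_Suc[OF DERIV_ident]]) simp

lemma deriv_bump: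
  fixes z :: complex
  shows "deriv (bump n R) z = of_real (bump_coeff n R) * (of_nat (n + 2) * z ^ (n + 1) - 1)"
  unfolding bump_def[abs_def] using has_field_derivative_power_Suc[of "n + 1" z]
  by (intro DERIV_imp_deriv DERIV_cmult DERIV_diff DERIV_ident) simp

lemma deriv2_bump:
  fixes z :: complex
  assumes "R \<noteq> 0"
  shows "(deriv ^^ 2) (bump n R) z = 2 * (z / of_real R) ^ n"
proof -
  have "(deriv ^^ 2) (bump n R) z
      = deriv (\<lambda>z. of_real (bump_coeff n R) * (of_nat (n + 2) * z ^ (n + 1) - 1)) z"
    by (simp add: numeral_2_eq_2 deriv_bump[abs_def])
  also have "\<dots> = of_real (bump_coeff n R) * (of_nat (n + 2) * (of_nat (n + 1) * z ^ n) - 0)"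
    using has_field_derivative_power_Suc[of n z]
    by (intro DERIV_imp_deriv DERIV_cmult DERIV_diff DERIV_const) simp
  also have "\<dots> = of_real (bump_coeff n R * real (n + 2) * real (n + 1)) * z ^ n"
    by (simp only: of_real_mult of_real_of_nat_eq mult.assoc diff_zero)
  also have "bump_coeff n R * real (n + 2) * real (n + 1) = 2 / R ^ n"
  proof -
    have "2 / (u * v * w) * u * v = 2 / w" if "u \<noteq> 0" "v \<noteq> 0" for u v w :: real
      using that by simp
    from this[of "real (n + 2)" "real (n + 1)" "R ^ n"] show ?thesis
      unfolding bump_coeff_def by simp
  qed
  finally show ?thesis by (simp add: power_divide)
qed

lemma norm_bump_le:
  fixes z :: complex
  assumes "1 \<le> R" "cmod z \<le> R"
  shows "cmod (bump n R z) \<le> 4 * R\<^sup>2 / real (n + 1)"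
proof -
  have "cmod z \<le> R ^ (n + 2)"
    using assms power_increasing[of 1 "n + 2" R] by (simp del: power_Suc add_2_eq_Suc')
  moreover have "cmod z ^ (n + 2) \<le> R ^ (n + 2)"
    using assms by (intro power_mono) auto
  ultimately have "cmod (z ^ (n + 2) - z) \<le> R ^ (n + 2) + R ^ (n + 2)"
    by (intro norm_triangle_le_diff add_mono) (simp_all only: norm_power)
  then have "cmod (bump n R z) \<le> bump_coeff n R * (R ^ (n + 2) + R ^ (n + 2))"
    unfolding bump_def using assms bump_coeff_nonneg[of R n] by (intro norm_mult_mono) auto
  also have "\<dots> = 2 * R\<^sup>2 * (bump_coeff n R * R ^ n)"
    by (simp add: power_add algebra_simps power2_eq_square)
  also have "\<dots> = 4 * R\<^sup>2 / real (n + 1) / real (n + 2)"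
    using assms by (simp add: bump_coeff_mult_power)
  also have "\<dots> \<le> 4 * R\<^sup>2 / real (n + 1)"
    using assms by (simp add: divide_le_eq mult_le_cancel_left1)
  finally show ?thesis .
qed

lemma norm_deriv_bump_le:
  assumes "1 \<le> R" "cmod z \<le> R"
  shows "cmod (deriv (bump n R) z) \<le> 4 * R\<^sup>2 / real (n + 1)"
proof -
  have "1 * 1 \<le> real (n + 2) * R ^ (n + 1)"
    using assms(1) by (intro mult_mono one_le_power) auto
  moreover have "real (n + 2) * cmod z ^ (n + 1) \<le> real (n + 2) * R ^ (n + 1)"
    using assms by (intro mult_left_mono power_mono) auto
  ultimately have "cmod (of_nat (n + 2) * z ^ (n + 1) - 1)
    \<le> real (n + 2) * R ^ (n + 1) + real (n + 2) * R ^ (n + 1)"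
    by (intro norm_triangle_le_diff add_mono)
      (simp_all only: norm_mult norm_power norm_of_nat norm_one mult_1)
  then have "cmod (deriv (bump n R) z)
    \<le> bump_coeff n R * (real (n + 2) * R ^ (n + 1) + real (n + 2) * R ^ (n + 1))"
    unfolding deriv_bump using assms bump_coeff_nonneg[of R n] by (intro norm_mult_mono) auto
  also have "\<dots> = 2 * real (n + 2) * R * (bump_coeff n R * R ^ n)"
    by (simp add: algebra_simps)
  also have "\<dots> = 4 * R / real (n + 1)"
  proof -
    have "2 * u * R * (2 / (u * v)) = 4 * R / v" if "u \<noteq> 0" for u v :: real
      using that by simp
    from this[of "real (n + 2)" "real (n + 1)"] show ?thesis
      using assms by (simp add: bump_coeff_mult_power)
  qed
  also have "\<dots> \<le> 4 * R\<^sup>2 / real (n + 1)"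
    using assms by (intro divide_right_mono) (auto simp: power2_eq_square)
  finally show ?thesis .
qed

definition curvature_bump ::
  "real \<Rightarrow> real \<Rightarrow> real \<Rightarrow> real \<Rightarrow> (real \<Rightarrow> real) \<Rightarrow> (complex \<Rightarrow> complex) \<Rightarrow> bool" where
  "curvature_bump R R' t x f \<phi> \<longleftrightarrow> complexification_on UNIV f \<phi> \<and> f 0 = 0 \<and> f 1 = 0 \<and>
    (deriv ^^ 2) \<phi> (of_real x) = 1 \<and>
    (\<forall>z. cmod z \<le> R \<longrightarrow> cmod (\<phi> z) \<le> t \<and> cmod (deriv \<phi> z) \<le> t) \<and>
    (\<forall>z. cmod z \<le> R' \<longrightarrow> cmod ((deriv ^^ 2) \<phi> z) \<le> t)"

text \<open>At \<open>R * root n (1 / 2)\<close> the second derivative of the bump is half of its maximum on the disc of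
  radius \<open>R\<close>, while on smaller discs it decays geometrically in \<open>n\<close>.\<close>

lemma curvature_bump_exists:
  assumes R: "1 \<le> R" "0 \<le> R'" "R' < R" and "0 < t"
  obtains x f \<phi> where "0 < x" "x < R" "curvature_bump R R' t x f \<phi>"
proof -
  have "(\<lambda>n. 2 * (R' / R) ^ n) \<longlonglongrightarrow> 0"
    using R by (intro tendsto_mult_right_zero LIMSEQ_power_zero) simp
  then have "\<forall>\<^sub>F n in sequentially. 2 * (R' / R) ^ n < t"
    using \<open>0 < t\<close> by (rule order_tendstoD(2))
  moreover have "\<forall>\<^sub>F n in sequentially. 4 * R\<^sup>2 / real (n + 1) < t"
  proof (rule order_tendstoD(2)[OF _ \<open>0 < t\<close>])
    show "(\<lambda>n. 4 * R\<^sup>2 / real (n + 1)) \<longlonglongrightarrow> 0"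
      using LIMSEQ_Suc[OF lim_const_over_n[of "4 * R\<^sup>2"]] by simp
  qed
  moreover have "\<forall>\<^sub>F n::nat in sequentially. 0 < n" by (rule eventually_gt_at_top)
  ultimately have "\<forall>\<^sub>F n in sequentially. 2 * (R' / R) ^ n < t \<and> 4 * R\<^sup>2 / real (n + 1) < t \<and> 0 < n"
    by eventually_elim auto
  then obtain n where n: "2 * (R' / R) ^ n < t" "4 * R\<^sup>2 / real (n + 1) < t" "0 < n"
    using eventually_happens'[OF sequentially_bot] by blast
  show ?thesis
  proof (rule that)
    show "0 < R * root n (1 / 2)" "R * root n (1 / 2) < R"
      using R n(3) by simp_all
    have "(deriv ^^ 2) (bump n R) (of_real (R * root n (1 / 2))) = (1 :: complex)"
      using R n(3) by (simp add: deriv2_bump flip: of_real_power)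
    moreover have "cmod ((deriv ^^ 2) (bump n R) z) \<le> t" if "cmod z \<le> R'" for z
    proof -
      have "cmod ((deriv ^^ 2) (bump n R) z) = 2 * (cmod z / R) ^ n"
        using R by (simp add: deriv2_bump norm_mult norm_power norm_divide)
      also have "\<dots> \<le> 2 * (R' / R) ^ n"
        using that R by (intro mult_left_mono power_mono divide_right_mono) auto
      finally show ?thesis using n(1) by simp
    qed
    moreover have "cmod (bump n R z) \<le> t" "cmod (deriv (bump n R) z) \<le> t" if "cmod z \<le> R" for z
      using norm_bump_le[OF R(1) that, of n] norm_deriv_bump_le[OF R(1) that, of n] n(2)
      by linarith+
    ultimately show "curvature_bump R R' t (R * root n (1 / 2)) (bump n R) (bump n R)"
      using complexification_on_bump[of UNIV n R]
      by (simp add: curvature_bump_def bump_def[of n R "0::real"] bump_def[of n R "1::real"])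
  qed
qed

lemma higher_deriv_add_cmult:
  fixes z :: complex
  assumes "f holomorphic_on S" "g holomorphic_on S" "open S" "z \<in> S"
  shows "(deriv ^^ j) (\<lambda>w. f w + c * g w) z = (deriv ^^ j) f z + c * (deriv ^^ j) g z"
  using higher_deriv_add[of f S "\<lambda>w. c * g w" z j] higher_deriv_cmult[of g S z j c] assms
  by (simp add: holomorphic_on_mult)

lemma coefficient_prescribing_quotient:
  fixes y d d' p T L t :: real
  assumes y: "\<bar>y\<bar> \<le> T" and d: "\<bar>d\<bar> \<le> 1" "\<bar>d'\<bar> \<le> L" and "\<bar>p\<bar> \<le> t" and "T * t \<le> 1 / 2"
  obtains \<tau> where "d' + \<tau> = y * (d + \<tau> * p)" "\<bar>\<tau>\<bar> \<le> 2 * (T + L)"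
proof (rule that)
  have "\<bar>y * p\<bar> \<le> T * t" unfolding abs_mult using y \<open>\<bar>p\<bar> \<le> t\<close> by (intro mult_mono) auto
  then have denom: "1 / 2 \<le> 1 - y * p" using \<open>T * t \<le> 1 / 2\<close> by linarith
  let ?\<tau> = "(y * d - d') / (1 - y * p)"
  have "d' + u = y * (d + u * p)" if "u * (1 - y * p) = y * d - d'" for u
    using that by (simp add: algebra_simps)
  then show "d' + ?\<tau> = y * (d + ?\<tau> * p)" using denom by simp
  have "\<bar>y * d\<bar> \<le> T * 1" unfolding abs_mult using y d by (intro mult_mono) auto
  then have "\<bar>y * d - d'\<bar> \<le> T + L" using d(2) by linarith
  then have "\<bar>?\<tau>\<bar> \<le> (T + L) / (1 / 2)"
    unfolding abs_divide using denom by (intro frac_le) auto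
  then show "\<bar>?\<tau>\<bar> \<le> 2 * (T + L)" by simp
qed

lemma small_factor_exists:
  fixes a b c d :: real
  assumes "0 \<le> a" "0 \<le> b" "0 < c" "0 < d"
  obtains t where "0 < t" "a * t \<le> c" "b * t \<le> d"
proof (rule that)
  let ?t = "min c d / (a + b + 1)"
  show "0 < ?t" using assms by simp
  have "(a + b + 1) * ?t = min c d" using assms by simp
  moreover have "a * ?t \<le> (a + b + 1) * ?t" "b * ?t \<le> (a + b + 1) * ?t"
    using assms by (intro mult_right_mono; simp)+
  ultimately show "a * ?t \<le> c" "b * ?t \<le> d" by linarith+
qed

context analytic_ifs
begin

definition perturbation :: "nat \<Rightarrow> real \<Rightarrow> (real \<Rightarrow> real) \<Rightarrow> (complex \<Rightarrow> complex) \<Rightarrow> bool" where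
  "perturbation k e \<psi> g \<longleftrightarrow> complexification_on (B_nbhd (2 * \<epsilon>)) \<psi> g \<and> \<psi> 0 = \<Phi> k 0 \<and> \<psi> 1 = \<Phi> k 1 \<and>
    (\<forall>z\<in>closure (B_nbhd \<epsilon>). cmod (F k z - g z) \<le> e \<and> cmod (deriv (F k) z - deriv g z) \<le> e) \<and>
    (\<forall>z\<in>B_nbhd (\<epsilon> - \<sigma> / 2). cmod ((deriv ^^ 2) (F k) z - (deriv ^^ 2) g z) \<le> e)"

lemma perturbationD:
  assumes "perturbation k e \<psi> g"
  shows "complexification_on (B_nbhd (2 * \<epsilon>)) \<psi> g" "\<psi> 0 = \<Phi> k 0" "\<psi> 1 = \<Phi> k 1"
    "z \<in> closure (B_nbhd \<epsilon>) \<Longrightarrow> cmod (F k z - g z) \<le> e"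
    "z \<in> closure (B_nbhd \<epsilon>) \<Longrightarrow> cmod (deriv (F k) z - deriv g z) \<le> e"
    "z \<in> B_nbhd (\<epsilon> - \<sigma> / 2) \<Longrightarrow> cmod ((deriv ^^ 2) (F k) z - (deriv ^^ 2) g z) \<le> e"
  using assms by (auto simp: perturbation_def)

lemma inner_nbhd_subset: "B_nbhd (\<epsilon> - \<sigma> / 2) \<subseteq> B_nbhd \<epsilon>" "B_nbhd (\<epsilon> - \<sigma> / 2) \<subseteq> closure (B_nbhd \<epsilon>)"
  using B_nbhd_mono[of "\<epsilon> - \<sigma> / 2" \<epsilon>] margin B_nbhd_subset_closure by auto

context
  fixes k e \<psi> g
  assumes k: "k \<in> {1..N}" and pert: "perturbation k e \<psi> g" and e: "e \<le> \<sigma> / 2"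
begin

lemma perturbation_maps:
  assumes z: "z \<in> closure (B_nbhd \<epsilon>)"
  shows "g z \<in> B_nbhd (\<epsilon> - \<sigma> / 2)"
  using cball_subset_B_nbhd[OF maps_margin[OF k z], of "\<sigma> / 2"] perturbationD(4)[OF pert z] e
  by (auto simp: dist_norm)

lemma perturbation_deriv_bounds:
  assumes "z \<in> closure (B_nbhd \<epsilon>)"
  shows "\<sigma> / 2 \<le> cmod (deriv g z)" "cmod (deriv g z) \<le> 1 - \<sigma> / 2"
  using norm_deriv_bounds_if_close[OF k assms] perturbationD(5)[OF pert assms] e
  by (auto intro: order_trans)

lemma perturbation_nonlin_le:
  assumes z: "z \<in> B_nbhd (\<epsilon> - \<sigma> / 2)"
  shows "cmod (nonlin g z) \<le> 2 * \<Lambda> + 1"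
proof -
  have zK: "z \<in> closure (B_nbhd \<epsilon>)" using z inner_nbhd_subset(2) by blast
  have "cmod (nonlin (F k) z - nonlin g z) \<le> 2 * (1 + \<Lambda>) / \<sigma> * e"
    by (rule norm_nonlin_diff_le_if_close[OF k zK e perturbationD(5)[OF pert zK]
          perturbationD(6)[OF pert z]])
  also have "\<dots> \<le> 2 * (1 + \<Lambda>) / \<sigma> * (\<sigma> / 2)"
    using e margin nonlin_bound_nonneg by (intro mult_left_mono) auto
  also have "\<dots> = 1 + \<Lambda>" using margin by simp
  finally show ?thesis
    using nonlin_le[OF k zK] norm_triangle_sub[of "nonlin g z" "nonlin (F k) z"]
    by (simp add: norm_minus_commute)
qed

lemma analytic_ext_if_perturbation: "analytic_ext \<epsilon> \<psi> g"
  unfolding analytic_ext_def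
proof (intro conjI ballI)
  show compl: "complexification_on (B_nbhd (2 * \<epsilon>)) \<psi> g" by (rule perturbationD(1)[OF pert])
  have "\<sigma> / 2 \<le> cmod (deriv g (of_real x))" if "x \<in> {0..1}" for x
    using that unit_seg_subset(2) by (intro perturbation_deriv_bounds(1)) blast
  then have "\<psi> ` {0..1} = closed_segment (\<psi> 0) (\<psi> 1)"
    using margin
    by (intro complexification_on_image_interval[OF open_B_nbhd compl unit_seg_subset(3),
          where m = "\<sigma> / 2"]) auto
  also have "\<dots> \<subseteq> {0..1}"
    using analytic_extD(2)[OF ext[OF k]]
    by (intro closed_segment_subset) (auto simp: perturbationD(2,3)[OF pert] image_subset_iff)
  finally show "\<psi> ` {0..1} \<subseteq> {0..1}" .
  show "g ` closure (B_nbhd \<epsilon>) \<subseteq> B_nbhd \<epsilon>"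
    using perturbation_maps inner_nbhd_subset(1) by blast
  show "0 < cmod (deriv g z)" "cmod (deriv g z) < 1" if "z \<in> closure (B_nbhd \<epsilon>)" for z
    using perturbation_deriv_bounds[OF that] margin by linarith+
qed

lemma d2_perturbation_le: "d2 (\<Phi> k) \<psi> \<le> 3 * e"
proof (rule d2_le[OF open_B_nbhd unit_seg_subset(3) analytic_extD(1)[OF ext[OF k]]
      perturbationD(1)[OF pert]])
  fix j :: nat and z :: complex assume "j \<le> 2" and z: "z \<in> unit_seg"
  have "z \<in> B_nbhd (\<epsilon> - \<sigma> / 2)" using z unit_seg_subset_B_nbhd[of "\<epsilon> - \<sigma> / 2"] margin by auto
  moreover have "z \<in> closure (B_nbhd \<epsilon>)" using z unit_seg_subset(2) by blast
  moreover have "j = 0 \<or> j = 1 \<or> j = 2" using \<open>j \<le> 2\<close> by auto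
  ultimately show "cmod ((deriv ^^ j) (F k) z - (deriv ^^ j) g z) \<le> e"
    using perturbationD(4-6)[OF pert] by auto
qed

end

lemma perturbation_add_bump:
  assumes k: "k \<in> {1..N}" and bump: "curvature_bump (1 + \<epsilon>) (1 + \<epsilon> - \<sigma> / 2) t x f \<phi>"
    and \<tau>: "\<bar>\<tau>\<bar> * t \<le> e"
  shows "perturbation k e (\<lambda>x. \<Phi> k x + \<tau> * f x) (\<lambda>z. F k z + of_real \<tau> * \<phi> z)"
    (is "perturbation _ _ _ ?g")
  unfolding perturbation_def
proof (intro conjI ballI)
  let ?S = "B_nbhd (2 * \<epsilon>)"
  have \<phi>: "complexification_on ?S f \<phi>"
    using bump complexification_on_subset unfolding curvature_bump_def by blast
  note F = analytic_extD(1)[OF ext[OF k]]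
  have K_subset: "closure (B_nbhd \<epsilon>) \<subseteq> ?S"
    using eps_pos by (intro closure_B_nbhd_subset_B_nbhd) simp
  have close: "cmod ((deriv ^^ j) (F k) z - (deriv ^^ j) ?g z) \<le> e"
    if "z \<in> ?S" "cmod ((deriv ^^ j) \<phi> z) \<le> t" for j z
  proof -
    have "cmod ((deriv ^^ j) (F k) z - (deriv ^^ j) ?g z) = \<bar>\<tau>\<bar> * cmod ((deriv ^^ j) \<phi> z)"
      unfolding higher_deriv_add_cmult[OF complexification_onD(1)[OF F] complexification_onD(1)[OF \<phi>]
          open_B_nbhd that(1)] by (simp add: norm_mult)
    also have "\<dots> \<le> \<bar>\<tau>\<bar> * t" using that(2) by (intro mult_left_mono) auto
    finally show ?thesis using \<tau> by linarith
  qed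
  show "complexification_on ?S (\<lambda>x. \<Phi> k x + \<tau> * f x) ?g"
    by (rule complexification_on_add_cmult[OF F \<phi>])
  show "\<Phi> k 0 + \<tau> * f 0 = \<Phi> k 0" "\<Phi> k 1 + \<tau> * f 1 = \<Phi> k 1"
    using bump by (simp_all add: curvature_bump_def)
  show "cmod (F k z - ?g z) \<le> e" "cmod (deriv (F k) z - deriv ?g z) \<le> e"
    if z: "z \<in> closure (B_nbhd \<epsilon>)" for z
    using close[of z 0] close[of z 1] z K_subset bump norm_le_if_in_closure_B_nbhd[OF z]
    by (auto simp: curvature_bump_def)
  show "cmod ((deriv ^^ 2) (F k) z - (deriv ^^ 2) ?g z) \<le> e" if z: "z \<in> B_nbhd (\<epsilon> - \<sigma> / 2)" for z
    using close[of z 2] z inner_nbhd_subset(2) K_subset bump norm_less_if_in_B_nbhd[OF z]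
    by (auto simp: curvature_bump_def)
qed

lemma derivs_of_real:
  assumes k: "k \<in> {1..N}" and x: "of_real x \<in> closure (B_nbhd \<epsilon>)"
  shows "deriv (F k) (of_real x) = of_real (deriv (\<Phi> k) x)"
    "(deriv ^^ 2) (F k) (of_real x) = of_real ((deriv ^^ 2) (\<Phi> k) x)"
    "\<bar>deriv (\<Phi> k) x\<bar> \<le> 1" "\<bar>(deriv ^^ 2) (\<Phi> k) x\<bar> \<le> \<Lambda>"
proof -
  have "of_real x \<in> B_nbhd (2 * \<epsilon>)"
    using x closure_B_nbhd_subset_B_nbhd[of \<epsilon> "2 * \<epsilon>"] eps_pos by auto
  note F = complexification_onD(2)[OF complexification_on_higher_deriv[OF open_B_nbhd
        analytic_extD(1)[OF ext[OF k]]] this]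
  show F1: "deriv (F k) (of_real x) = of_real (deriv (\<Phi> k) x)" using F[of 1] by simp
  show F2: "(deriv ^^ 2) (F k) (of_real x) = of_real ((deriv ^^ 2) (\<Phi> k) x)" by (rule F)
  show \<Phi>1: "\<bar>deriv (\<Phi> k) x\<bar> \<le> 1" using deriv_le[OF k x] margin by (simp add: F1)
  have "\<bar>(deriv ^^ 2) (\<Phi> k) x\<bar> \<le> \<Lambda> * \<bar>deriv (\<Phi> k) x\<bar>"
    using nonlin_le[OF k x] deriv_ge[OF k x] margin
    by (simp add: nonlin_def F1 F2 norm_divide divide_le_eq)
  also have "\<dots> \<le> \<Lambda>" using \<Phi>1 nonlin_bound_nonneg by (simp add: mult_left_le)
  finally show "\<bar>(deriv ^^ 2) (\<Phi> k) x\<bar> \<le> \<Lambda>" .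
qed

text \<open>The nonlinearity of \<open>F k + \<tau> * \<phi>\<close> at a point where \<open>\<phi>'' = 1\<close> is
  \<open>(F k'' + \<tau>) / (F k' + \<tau> * \<phi>')\<close>; solving for \<open>\<tau>\<close> prescribes it.\<close>

lemma perturbation_with_prescribed_nonlin:
  assumes k: "k \<in> {1..N}" and bump: "curvature_bump (1 + \<epsilon>) (1 + \<epsilon> - \<sigma> / 2) t x f \<phi>"
    and x: "of_real x \<in> B_nbhd \<epsilon>" and y: "\<bar>y\<bar> \<le> T"
    and t: "0 \<le> t" "T * t \<le> 1 / 2" "2 * (T + \<Lambda>) * t \<le> e" and e: "e \<le> \<sigma> / 2"
  obtains \<psi> g where "perturbation k e \<psi> g" "nonlin g (of_real x) = of_real y"
proof -
  let ?x = "complex_of_real x" and ?d = "deriv (\<Phi> k) x" and ?d' = "(deriv ^^ 2) (\<Phi> k) x"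
  have xK: "?x \<in> closure (B_nbhd \<epsilon>)" using x B_nbhd_subset_closure by blast
  note F = derivs_of_real[OF k xK]
  have \<phi>: "complexification_on UNIV f \<phi>" "(deriv ^^ 2) \<phi> ?x = 1"
    using bump by (simp_all add: curvature_bump_def)
  have \<phi>': "deriv \<phi> ?x = of_real (deriv f x)"
    using complexification_onD(2)[OF complexification_on_deriv[OF open_UNIV \<phi>(1)]] by simp
  have "cmod (deriv \<phi> ?x) \<le> t"
    using bump norm_le_if_in_closure_B_nbhd[OF xK] unfolding curvature_bump_def by blast
  then have "\<bar>deriv f x\<bar> \<le> t" by (simp add: \<phi>')
  then obtain \<tau> where \<tau>: "?d' + \<tau> = y * (?d + \<tau> * deriv f x)" "\<bar>\<tau>\<bar> \<le> 2 * (T + \<Lambda>)"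
    using coefficient_prescribing_quotient[OF y F(3,4) _ t(2)] by blast
  define g where "g = (\<lambda>z. F k z + of_real \<tau> * \<phi> z)"
  have "\<bar>\<tau>\<bar> * t \<le> e" using mult_right_mono[OF \<tau>(2) t(1)] t(3) by linarith
  then have pert: "perturbation k e (\<lambda>x. \<Phi> k x + \<tau> * f x) g"
    unfolding g_def by (rule perturbation_add_bump[OF k bump])
  have g: "(deriv ^^ j) g ?x = (deriv ^^ j) (F k) ?x + of_real \<tau> * (deriv ^^ j) \<phi> ?x" for j
    unfolding g_def using x holomorphic[OF k] complexification_onD(1)[OF \<phi>(1)] open_domain
    by (intro higher_deriv_add_cmult[where S = "B_nbhd \<epsilon>"]) (auto intro: holomorphic_on_subset)
  have g': "deriv g ?x = of_real (?d + \<tau> * deriv f x)" "(deriv ^^ 2) g ?x = of_real (?d' + \<tau>)"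
    using g[of 1] g[of 2] by (simp_all add: F \<phi> \<phi>')
  have "0 < cmod (deriv g ?x)"
    using perturbation_deriv_bounds(1)[OF k pert e xK] margin by linarith
  then have "nonlin g ?x = of_real y"
    unfolding nonlin_def g' \<tau>(1) by (simp flip: of_real_mult of_real_add of_real_divide)
  with pert show ?thesis by (rule that)
qed

lemma nonlin_gap_if_point_gap:
  assumes "z \<in> B_nbhd \<epsilon>" "0 < \<eta>"
    and gap: "\<And>k l v w. k \<noteq> l \<Longrightarrow> set (k # v) \<subseteq> {1..N} \<Longrightarrow> set (l # w) \<subseteq> {1..N} \<Longrightarrow>
      \<eta> \<le> cmod (nonlin (fold F (k # v)) z - nonlin (fold F (l # w)) z)"
  obtains \<delta> where "0 < \<delta>" "nonlin_gap {1..N} F \<delta>"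
proof -
  have "{z} \<subseteq> B_nbhd \<epsilon>" using assms(1) by simp
  obtain c E where "0 < c" and large: "\<And>g. g \<in> bounded_holomorphic (B_nbhd \<epsilon>) (\<Lambda> / \<sigma> + \<Lambda> / \<sigma>) \<Longrightarrow>
      \<exists>u\<in>{z}. \<eta> \<le> cmod (g u) \<Longrightarrow> large_on_subintervals c E g"
    by (rule large_on_subintervals_by_normality[OF open_domain connected_B_nbhd unit_seg_subset(1)
          compact_sing \<open>{z} \<subseteq> B_nbhd \<epsilon>\<close> \<open>0 < \<eta>\<close>]) blast
  have "nonlin_gap {1..N} F (c ^ E)"
  proof (rule nonlin_gapI)
    fix k l v w assume "k \<noteq> l" and kv: "set (k # v) \<subseteq> {1..N}" and lw: "set (l # w) \<subseteq> {1..N}"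
    then have "\<exists>u\<in>{z}. \<eta> \<le> cmod (nonlin (fold F (k # v)) u - nonlin (fold F (l # w)) u)"
      using gap by blast
    then have "large_on_subintervals c E (\<lambda>u. nonlin (fold F (k # v)) u - nonlin (fold F (l # w)) u)"
      by (intro large bounded_holomorphic_diff nonlin_fold_bounded_holomorphic kv lw)
    then obtain x where "x \<in> {0..1}" "(c * 1) ^ E
        \<le> cmod (nonlin (fold F (k # v)) (of_real x) - nonlin (fold F (l # w)) (of_real x))"
      by (rule large_on_subintervalsD[where a = 0 and b = 1 and l = 1]) simp_all
    then show "\<exists>u\<in>unit_seg. c ^ E \<le> cmod (nonlin (fold F (k # v)) u - nonlin (fold F (l # w)) u)"
      by auto
  qed
  with \<open>0 < c\<close> show ?thesis by (intro that[of "c ^ E"]) simp_all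
qed

lemma norm_nonlin_fold_perturbation_le:
  assumes e: "e \<le> \<sigma> / 2" and pert: "\<And>k. k \<in> {1..N} \<Longrightarrow> perturbation k e (\<Psi> k) (G k)"
    and z: "z \<in> B_nbhd \<epsilon>" and kv: "set (k # v) \<subseteq> {1..N}"
  shows "cmod (nonlin (fold G (k # v)) z - nonlin (G k) z) \<le> 2 * (2 * \<Lambda> + 1) / \<sigma>"
proof -
  interpret G: conformal_ifs "B_nbhd \<epsilon>" "{1..N}" G
    using eps_pos analytic_ext_if_perturbation[OF _ pert e] by (rule conformal_ifs_if_analytic_ext)
  let ?B = "B_nbhd (\<epsilon> - \<sigma> / 2)"
  have maps: "G i u \<in> ?B" and deriv: "cmod (deriv (G i) u) \<le> 1 - \<sigma> / 2"
    if "i \<in> {1..N}" "u \<in> closure (B_nbhd \<epsilon>)" for i u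
    using perturbation_maps[OF that(1) pert[OF that(1)] e that(2)]
      perturbation_deriv_bounds(2)[OF that(1) pert[OF that(1)] e that(2)] by auto
  have k: "k \<in> {1..N}" and v: "set v \<subseteq> {1..N}" using kv by auto
  have zK: "z \<in> closure (B_nbhd \<epsilon>)" using z B_nbhd_subset_closure by blast
  have "cmod (nonlin (fold G v) (G k z)) \<le> (2 * \<Lambda> + 1) / (1 - (1 - \<sigma> / 2))"
  proof (rule G.norm_nonlin_fold_le[where X = ?B, OF _ _ _ _ _ _ v maps[OF k zK]])
    fix i assume i: "i \<in> {1..N}"
    show "G i ` ?B \<subseteq> ?B" using maps[OF i] inner_nbhd_subset(2) by blast
    show "cmod (deriv (G i) u) \<le> 1 - \<sigma> / 2" if "u \<in> ?B" for u
      using deriv[OF i] that inner_nbhd_subset(2) by blast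
    show "cmod (nonlin (G i) u) \<le> 2 * \<Lambda> + 1" if "u \<in> ?B" for u
      by (rule perturbation_nonlin_le[OF i pert[OF i] e that])
  qed (use margin nonlin_bound_nonneg inner_nbhd_subset(1) in auto)
  moreover have "cmod (deriv (G k) z) \<le> 1" using deriv[OF k zK] margin by linarith
  ultimately have "cmod (deriv (G k) z * nonlin (fold G v) (G k z))
    \<le> 1 * ((2 * \<Lambda> + 1) / (1 - (1 - \<sigma> / 2)))"
    by (intro norm_mult_mono)
  then show ?thesis unfolding G.nonlin_fold_Cons[OF kv z] by simp
qed

lemma nonlin_gap_if_separated_perturbation:
  assumes e: "e \<le> \<sigma> / 2" and pert: "\<And>k. k \<in> {1..N} \<Longrightarrow> perturbation k e (\<Psi> k) (G k)"
    and z: "z \<in> B_nbhd \<epsilon>" and H: "4 * (2 * \<Lambda> + 1) / \<sigma> < H"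
    and nonlin_z: "\<And>k. k \<in> {1..N} \<Longrightarrow> nonlin (G k) z = of_real (real k * H)"
  obtains \<delta> where "0 < \<delta>" "nonlin_gap {1..N} G \<delta>"
proof -
  have extG: "analytic_ext \<epsilon> (\<Psi> k) (G k)" if "k \<in> {1..N}" for k
    using that e pert by (intro analytic_ext_if_perturbation)
  obtain \<sigma>' \<Lambda>' where G: "analytic_ifs \<epsilon> \<sigma>' \<Lambda>' N \<Psi> G"
    by (rule analytic_ifs_exists[OF eps_pos extG])
  let ?t = "2 * (2 * \<Lambda> + 1) / \<sigma>"
  have H: "0 < H - 2 * ?t" "0 < H"
    using H margin nonlin_bound_nonneg by (auto intro: le_less_trans[rotated])
  show ?thesis
  proof (rule analytic_ifs.nonlin_gap_if_point_gap[OF G z H(1) _ that])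
    fix k l v w assume "k \<noteq> l" and kv: "set (k # v) \<subseteq> {1..N}" and lw: "set (l # w) \<subseteq> {1..N}"
    have near: "cmod (nonlin (fold G (i # u)) z - of_real (real i * H)) \<le> ?t"
      if "set (i # u) \<subseteq> {1..N}" for i u
      using norm_nonlin_fold_perturbation_le[OF e pert z that] nonlin_z[of i] that by simp
    have "1 * H \<le> \<bar>real k - real l\<bar> * H"
      using H(2) \<open>k \<noteq> l\<close> by (intro mult_right_mono) linarith+
    also have "\<dots> = \<bar>real k * H - real l * H\<bar>"
      using H(2) by (simp add: abs_mult flip: left_diff_distrib)
    also have "\<dots> = cmod (of_real (real k * H) - of_real (real l * H))"
      by (simp only: of_real_diff[symmetric] norm_of_real)
    also have "\<dots> \<le> cmod (nonlin (fold G (k # v)) z - nonlin (fold G (l # w)) z) + ?t + ?t"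
    proof -
      have "cmod (a' - b') \<le> cmod (a - b) + cmod (a - a') + cmod (b - b')" for a b a' b' :: complex
        by norm
      then show ?thesis using near[OF kv] near[OF lw] by (meson add_mono order_refl order_trans)
    qed
    finally show "H - 2 * ?t \<le> cmod (nonlin (fold G (k # v)) z - nonlin (fold G (l # w)) z)"
      by simp
  qed
qed

theorem nonlin_gap_dense:
  assumes "0 < r"
  obtains \<Psi> G \<delta> where "\<And>k. k \<in> {1..N} \<Longrightarrow> analytic_ext \<epsilon> (\<Psi> k) (G k)"
    "\<And>k. k \<in> {1..N} \<Longrightarrow> d2 (\<Phi> k) (\<Psi> k) < r" "0 < \<delta>" "nonlin_gap {1..N} G \<delta>"
proof -
  define H where "H = 4 * (2 * \<Lambda> + 1) / \<sigma> + 1"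
  define T where "T = real N * H"
  define e where "e = min (\<sigma> / 2) (r / 4)"
  have "0 < H"
    unfolding H_def using margin nonlin_bound_nonneg by (intro add_nonneg_pos divide_nonneg_pos) auto
  then have "0 \<le> T" by (simp add: T_def)
  have e: "0 < e" "e \<le> \<sigma> / 2" "3 * e < r" using margin \<open>0 < r\<close> by (auto simp: e_def)
  obtain t where t: "0 < t" "T * t \<le> 1 / 2" "2 * (T + \<Lambda>) * t \<le> e"
    using small_factor_exists[of T "2 * (T + \<Lambda>)" "1 / 2" e] \<open>0 \<le> T\<close> nonlin_bound_nonneg e(1) by auto
  obtain x f \<phi> where x: "0 < x" "x < 1 + \<epsilon>"
    and bump: "curvature_bump (1 + \<epsilon>) (1 + \<epsilon> - \<sigma> / 2) t x f \<phi>"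
    using curvature_bump_exists[of "1 + \<epsilon>" "1 + \<epsilon> - \<sigma> / 2" t] margin \<open>0 < t\<close> by auto
  have xB: "of_real x \<in> B_nbhd \<epsilon>"
    unfolding B_nbhd_def
    using x eps_pos
    by (intro CollectI bexI[of _ "min x 1"]) (auto simp: min_def simp flip: of_real_diff)
  have "\<exists>\<psi> g. perturbation k e \<psi> g \<and> nonlin g (of_real x) = of_real (real k * H)"
    if "k \<in> {1..N}" for k
  proof -
    have "\<bar>real k * H\<bar> \<le> T"
      unfolding T_def abs_mult using that \<open>0 < H\<close> by (intro mult_mono) auto
    then show ?thesis
      using perturbation_with_prescribed_nonlin[OF that bump xB _ less_imp_le[OF t(1)] t(2,3) e(2)]
      by blast
  qed
  then obtain \<Psi> G where pert: "\<And>k. k \<in> {1..N} \<Longrightarrow> perturbation k e (\<Psi> k) (G k)"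
    and nonlin: "\<And>k. k \<in> {1..N} \<Longrightarrow> nonlin (G k) (of_real x) = of_real (real k * H)"
    by metis
  have "4 * (2 * \<Lambda> + 1) / \<sigma> < H" by (simp add: H_def)
  then obtain \<delta> where "0 < \<delta>" "nonlin_gap {1..N} G \<delta>"
    using nonlin_gap_if_separated_perturbation[OF e(2) pert xB _ nonlin] by blast
  moreover have "d2 (\<Phi> k) (\<Psi> k) < r" if "k \<in> {1..N}" for k
    using d2_perturbation_le[OF that pert[OF that] e(2)] e(3) by linarith
  ultimately show ?thesis
    using that analytic_ext_if_perturbation[OF _ pert e(2)] by blast
qed

end

section \<open>Openness and density\<close>

lemma d2_IFS_less_iff: "0 < N \<Longrightarrow> d2_IFS N \<Phi> \<Psi> < r \<longleftrightarrow> (\<forall>k\<in>{1..N}. d2 (\<Phi> k) (\<Psi> k) < r)"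
  unfolding d2_IFS_def by (subst Max_less_iff) auto

definition separated_IFS :: "real \<Rightarrow> nat \<Rightarrow> (nat \<Rightarrow> real \<Rightarrow> real) set" where
  "separated_IFS \<epsilon> N = {\<Phi> \<in> IFS \<epsilon> N. \<exists>F \<delta>. 0 < \<delta> \<and>
    (\<forall>k\<in>{1..N}. analytic_ext \<epsilon> (\<Phi> k) (F k)) \<and> nonlin_gap {1..N} F \<delta>}"

lemma IFS_imp_analytic_ifs:
  assumes "0 < \<epsilon>" "\<Phi> \<in> IFS \<epsilon> N"
  obtains \<sigma> \<Lambda> F where "analytic_ifs \<epsilon> \<sigma> \<Lambda> N \<Phi> F"
proof -
  have "\<forall>k\<in>{1..N}. \<exists>F. analytic_ext \<epsilon> (\<Phi> k) F"
    using assms(2) unfolding IFS_def S_omega_iff_analytic_ext[symmetric] by blast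
  then obtain F where "\<And>k. k \<in> {1..N} \<Longrightarrow> analytic_ext \<epsilon> (\<Phi> k) (F k)" by metis
  then show ?thesis using analytic_ifs_exists[OF assms(1)] that by metis
qed

lemma separated_IFSE:
  assumes "0 < \<epsilon>" "\<Phi> \<in> separated_IFS \<epsilon> N"
  obtains \<sigma> \<Lambda> F \<delta> where "analytic_ifs \<epsilon> \<sigma> \<Lambda> N \<Phi> F" "0 < \<delta>" "nonlin_gap {1..N} F \<delta>"
proof -
  obtain F \<delta> where F: "\<And>k. k \<in> {1..N} \<Longrightarrow> analytic_ext \<epsilon> (\<Phi> k) (F k)"
    and gap: "0 < \<delta>" "nonlin_gap {1..N} F \<delta>"
    using assms(2) unfolding separated_IFS_def by blast
  obtain \<sigma> \<Lambda> where "analytic_ifs \<epsilon> \<sigma> \<Lambda> N \<Phi> F"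
    by (rule analytic_ifs_exists[OF assms(1) F])
  then show ?thesis using gap by (rule that)
qed

lemma separated_IFS_imp_SESC:
  assumes "0 < \<epsilon>" "\<Phi> \<in> separated_IFS \<epsilon> N"
  shows "SESC N \<Phi>"
  using assms by (rule separated_IFSE) (rule analytic_ifs.SESC_if_nonlin_gap)

lemma openin_separated_IFS:
  assumes "0 < \<epsilon>" "0 < N"
  shows "openin (C2_topology \<epsilon> N) (separated_IFS \<epsilon> N)"
  unfolding openin_C2_topology
proof (intro conjI ballI)
  show "separated_IFS \<epsilon> N \<subseteq> IFS \<epsilon> N" by (auto simp: separated_IFS_def)
  fix \<Phi> assume "\<Phi> \<in> separated_IFS \<epsilon> N"
  then obtain \<sigma> \<Lambda> F \<delta> where F: "analytic_ifs \<epsilon> \<sigma> \<Lambda> N \<Phi> F" and \<delta>: "0 < \<delta>" "nonlin_gap {1..N} F \<delta>"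
    using separated_IFSE[OF assms(1)] by metis
  obtain r where "0 < r" and r: "\<And>\<Psi> G. (\<And>k. k \<in> {1..N} \<Longrightarrow> analytic_ext \<epsilon> (\<Psi> k) (G k)) \<Longrightarrow>
      (\<And>k. k \<in> {1..N} \<Longrightarrow> d2 (\<Phi> k) (\<Psi> k) \<le> r) \<Longrightarrow> nonlin_gap {1..N} G (\<delta> / 2)"
    by (rule analytic_ifs.nonlin_gap_stable[OF F \<delta>(2,1)]) blast
  have "\<Psi> \<in> separated_IFS \<epsilon> N" if \<Psi>: "\<Psi> \<in> IFS \<epsilon> N" "d2_IFS N \<Phi> \<Psi> < r" for \<Psi>
  proof -
    obtain \<sigma>' \<Lambda>' G where "analytic_ifs \<epsilon> \<sigma>' \<Lambda>' N \<Psi> G"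
      using IFS_imp_analytic_ifs[OF assms(1) \<Psi>(1)] .
    then have G: "analytic_ext \<epsilon> (\<Psi> k) (G k)" if "k \<in> {1..N}" for k
      using that by (rule analytic_ifs.ext)
    moreover have "nonlin_gap {1..N} G (\<delta> / 2)"
      using \<Psi>(2) unfolding d2_IFS_less_iff[OF assms(2)] by (intro r[OF G]) (auto intro: less_imp_le)
    ultimately show ?thesis
      unfolding separated_IFS_def using \<Psi>(1) half_gt_zero[OF \<delta>(1)] by blast
  qed
  with \<open>0 < r\<close> show "\<exists>r>0. {\<Psi> \<in> IFS \<epsilon> N. d2_IFS N \<Phi> \<Psi> < r} \<subseteq> separated_IFS \<epsilon> N" by blast
qed

lemma separated_IFS_approximation:
  assumes "0 < \<epsilon>" "0 < N" "\<Phi> \<in> IFS \<epsilon> N" "0 < r"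
  shows "\<exists>\<Psi>\<in>separated_IFS \<epsilon> N. d2_IFS N \<Phi> \<Psi> < r"
proof -
  obtain \<sigma> \<Lambda> F where F: "analytic_ifs \<epsilon> \<sigma> \<Lambda> N \<Phi> F"
    using IFS_imp_analytic_ifs[OF assms(1,3)] .
  obtain \<Psi> G \<delta> where \<Psi>: "\<And>k. k \<in> {1..N} \<Longrightarrow> analytic_ext \<epsilon> (\<Psi> k) (G k)"
    and d2: "\<And>k. k \<in> {1..N} \<Longrightarrow> d2 (\<Phi> k) (\<Psi> k) < r" and gap: "0 < \<delta>" "nonlin_gap {1..N} G \<delta>"
    by (rule analytic_ifs.nonlin_gap_dense[OF F \<open>0 < r\<close>]) blast
  have "restrict \<Psi> {1..N} \<in> IFS \<epsilon> N"
    unfolding IFS_def using \<Psi> S_omega_iff_analytic_ext by (intro restrict_PiE_iff[THEN iffD2]) blast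
  moreover have "\<forall>k\<in>{1..N}. analytic_ext \<epsilon> (restrict \<Psi> {1..N} k) (G k)"
    using \<Psi> by simp
  ultimately have "restrict \<Psi> {1..N} \<in> separated_IFS \<epsilon> N"
    unfolding separated_IFS_def using gap by blast
  moreover have "d2_IFS N \<Phi> (restrict \<Psi> {1..N}) < r"
    unfolding d2_IFS_less_iff[OF assms(2)] using d2 by simp
  ultimately show ?thesis by blast
qed

lemma closure_of_separated_IFS:
  assumes "0 < \<epsilon>" "0 < N"
  shows "(C2_topology \<epsilon> N) closure_of (separated_IFS \<epsilon> N) = IFS \<epsilon> N"
proof -
  have "\<exists>\<Psi>\<in>separated_IFS \<epsilon> N. \<Psi> \<in> T"
    if T: "\<Phi> \<in> T" "openin (C2_topology \<epsilon> N) T" for \<Phi> T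
  proof -
    obtain r where r: "0 < r" "{\<Psi> \<in> IFS \<epsilon> N. d2_IFS N \<Phi> \<Psi> < r} \<subseteq> T" and "\<Phi> \<in> IFS \<epsilon> N"
      using T unfolding openin_C2_topology by blast
    then obtain \<Psi> where "\<Psi> \<in> separated_IFS \<epsilon> N" "d2_IFS N \<Phi> \<Psi> < r"
      using separated_IFS_approximation[OF assms] by blast
    then show ?thesis using r(2) unfolding separated_IFS_def by blast
  qed
  then show ?thesis by (auto simp: closure_of_def)
qed

theorem theorem1p4:
  fixes \<epsilon> :: real and N :: nat
  assumes "\<epsilon> > 0" and "N > 0"
  shows "\<exists>U. U \<subseteq> {\<Phi> \<in> IFS \<epsilon> N. SESC N \<Phi>} \<and>
             openin (C2_topology \<epsilon> N) U \<and>
             (C2_topology \<epsilon> N) closure_of U = IFS \<epsilon> N"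
proof (intro exI conjI)
  show "separated_IFS \<epsilon> N \<subseteq> {\<Phi> \<in> IFS \<epsilon> N. SESC N \<Phi>}"
    using separated_IFS_imp_SESC[OF assms(1)] by (auto simp: separated_IFS_def)
  show "openin (C2_topology \<epsilon> N) (separated_IFS \<epsilon> N)"
    using assms by (rule openin_separated_IFS)
  show "(C2_topology \<epsilon> N) closure_of (separated_IFS \<epsilon> N) = IFS \<epsilon> N"
    using assms by (rule closure_of_separated_IFS)
qed

end
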